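(* Let $\gamma\in(0,1)$, $\epsilon\in(0,1)$ and $x\in\mathcal X$. Then $$\min_{\pi\in\hat\Pi^{\gamma}_{x,\epsilon}}J^{\gamma}_{\mathrm{S^3P}}(x;\pi)=\min_{\epsilon'\in(0,\epsilon]}c^*_{\gamma,\epsilon'}(x).$$ Moreover, if $\epsilon^*\in\arg\min_{\epsilon'\in(0,\epsilon]}c^*_{\gamma,\epsilon'}(x)$ (with $c^*_{\gamma,\epsilon^*}(x)$ finite), then $$\min_{\pi\in\hat\Pi^{\gamma}_{x,\epsilon}}J^{\gamma}_{\mathrm{S^3P}}(x;\pi)=\frac{1}{1-\epsilon^*}\,J^{(S)}_{obj}\bigl((x,0);\pi^*_{c^*_{\gamma,\epsilon^*}(x),\gamma,\epsilon^*}\bigr).$$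
   Context: $\mathcal M$ is a discrete-time Markov decision process with finite state set $\mathcal X=\{0,1,\dots,N_X\}$, finite action set $\mathcal C=\{1,\dots,N_C\}$ and countable disturbance set $\mathcal W$. When action $u_t$ is taken in state $x_t$, disturbance $w_t\in\mathcal W$ occurs with probability $p(w_t|x_t,u_t)$, the next state is $x_{t+1}=f(x_t,u_t,w_t)$, and a one-stage cost $g(x_t,u_t,w_t)\ge 0$ is incurred; for each fixed $(x,u)$ the mean and variance of $g(x,u,w)$ under $p(\cdot|x,u)$ are finite. State $0$ is terminal: $f(0,u,w)=0$ and $g(0,u,w)=0$ for all $u,w$. The total cost up to time $t$ is $r_t=\sum_{k<t}g(x_k,u_k,w_k)$. A policy $\pi=(\mu_0,\mu_1,\dots)$ selects action $u_t$ with probability $\mu_t(u_t|H_t)$, where $H_t=(x_0,r_0,u_0,\dots,x_t,r_t)$; $\Pi$ is the set of all policies. $E^{\mathcal M,\pi}$ denotes expectation when $\pi$ is applied to $\mathcal M$. Let $h_d(0)=0$, $h_d(x')=1$ for $x'\neq0$, and $$L_d^{\gamma}(x;\pi)=E^{\mathcal M,\pi}\Bigl\{\sum_{t=0}^{\infty}\gamma^t(1-\gamma)h_d(x_t)\Bigm|x_0=x\Bigr\},\qquad \hat\Pi^{\gamma}_{x,\epsilon}=\{\pi\in\Pi\mid L_d^{\gamma}(x;\pi)\le\epsilon\}.$$ Let $J^{(S)}_{obj}((x,0);\pi)=E^{\mathcal M,\pi}\{\mathbf 1[\exists t:\ x_t=0]\sum_{t=0}^{\infty}g(x_t,u_t,w_t)\mid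 x_0=x\}$ (the accumulated cost is charged only upon reaching state $0$) and $$J^{\gamma}_{\mathrm{S^3P}}(x;\pi)=\frac{1}{1-L_d^{\gamma}(x;\pi)}\,J^{(S)}_{obj}((x,0);\pi).$$ Let $\mathcal A$ be the set of pairs $\alpha=(\alpha_o,\alpha_d)$ with $\alpha_o,\alpha_d\ge0$, $\alpha_o+\alpha_d=1$ (probability distributions on the two MDPs corresponding to objective and constraint). For $c\ge0$ and $\epsilon'\in(0,1)$ put $$J_{c,\gamma,\epsilon'}((x,0),\alpha,\pi)=\alpha_o\,J^{(S)}_{obj}((x,0);\pi)+\frac{c(1-\epsilon')}{\epsilon'}\,\alpha_d\,L_d^{\gamma}(x;\pi)$$ (with $0\cdot\infty=0$), let $\pi^*_{c,\gamma,\epsilon'}$ denote a policy in $\arg\min_{\pi\in\Pi}\{\max_{\alpha\in\mathcal A}J_{c,\gamma,\epsilon'}((x,0),\alpha,\pi)\}$, and let $$c^*_{\gamma,\epsilon'}(x)=\min\Bigl\{c\in[0,\infty)\Bigm|\min_{\pi\in\Pi}\max_{\alpha\in\mathcal A}J_{c,\gamma,\epsilon'}((x,0),\alpha,\pi)\le c(1-\epsilon')\Bigr\}.$$ Minima over empty sets are read as $+\infty$.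
   Formalization: In the definition of c*, the minimum over c in [0,∞) is replaced by the infimum over c in (0,∞); with c=0 allowed, a policy that never reaches state 0 forces c*=0 and the claimed equality fails. *)

theory Defs
  imports "HOL-Probability.Probability"
begin

text \<open>
  The disturbance set is the whole of a countable type \<open>'w\<close>; \<open>pmf (trans M x u) w\<close>
  is \<open>p(w | x, u)\<close>.
\<close>

record 'w mdp =
  NX :: nat
  NC :: nat
  trans :: "nat \<Rightarrow> nat \<Rightarrow> 'w pmf"
  next_state :: "nat \<Rightarrow> nat \<Rightarrow> 'w \<Rightarrow> nat"
  stage_cost :: "nat \<Rightarrow> nat \<Rightarrow> 'w \<Rightarrow> real"

definition states :: "'w mdp \<Rightarrow> nat set" where
  "states M = {0..NX M}"

definition actions :: "'w mdp \<Rightarrow> nat set" where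
  "actions M = {1..NC M}"

definition is_mdp :: "'w mdp \<Rightarrow> bool" where
  "is_mdp M \<longleftrightarrow>
     (\<forall>x\<in>states M. \<forall>u\<in>actions M.
        (\<forall>w. next_state M x u w \<in> states M \<and> 0 \<le> stage_cost M x u w) \<and>
        integrable (measure_pmf (trans M x u)) (stage_cost M x u) \<and>
        integrable (measure_pmf (trans M x u))
          (\<lambda>w. (stage_cost M x u w
                 - measure_pmf.expectation (trans M x u) (stage_cost M x u))\<^sup>2)) \<and>
     (\<forall>u\<in>actions M. \<forall>w. next_state M 0 u w = 0 \<and> stage_cost M 0 u w = 0)"

text \<open>
  A history \<open>H\<^sub>t\<close> is a pair: the list of the triples \<open>(x\<^sub>k, r\<^sub>k, u\<^sub>k)\<close> for \<open>k < t\<close>,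
  and \<open>(x\<^sub>t, r\<^sub>t)\<close>.
\<close>

type_synonym history = "(nat \<times> real \<times> nat) list \<times> (nat \<times> real)"

type_synonym policy = "nat \<Rightarrow> history \<Rightarrow> nat pmf"

definition policies :: "'w mdp \<Rightarrow> policy set" where
  "policies M = {\<pi>. \<forall>t H. set_pmf (\<pi> t H) \<subseteq> actions M}"

text \<open>
  A sample path is the sequence \<open>\<omega>\<close> of the pairs \<open>(u\<^sub>t, w\<^sub>t)\<close>. Given \<open>x\<^sub>0 = x\<close>, it determines
  the states, the accumulated costs and the histories. Since \<open>'w\<close> is countable, finite
  prefixes of paths form a discrete measurable space, so the kernels below are measurable
  for every policy even though histories contain reals.
\<close>

primrec state_at :: "'w mdp \<Rightarrow> nat \<Rightarrow> (nat \<Rightarrow> nat \<times> 'w) \<Rightarrow> nat \<Rightarrow> nat" where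
  "state_at M x \<omega> 0 = x"
| "state_at M x \<omega> (Suc t) = next_state M (state_at M x \<omega> t) (fst (\<omega> t)) (snd (\<omega> t))"

definition cost_at :: "'w mdp \<Rightarrow> nat \<Rightarrow> (nat \<Rightarrow> nat \<times> 'w) \<Rightarrow> nat \<Rightarrow> real" where
  "cost_at M x \<omega> t = stage_cost M (state_at M x \<omega> t) (fst (\<omega> t)) (snd (\<omega> t))"

definition total_cost :: "'w mdp \<Rightarrow> nat \<Rightarrow> (nat \<Rightarrow> nat \<times> 'w) \<Rightarrow> nat \<Rightarrow> real" where
  "total_cost M x \<omega> t = (\<Sum>k<t. cost_at M x \<omega> k)"

definition history_at :: "'w mdp \<Rightarrow> nat \<Rightarrow> (nat \<Rightarrow> nat \<times> 'w) \<Rightarrow> nat \<Rightarrow> history" where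
  "history_at M x \<omega> t =
     (map (\<lambda>k. (state_at M x \<omega> k, total_cost M x \<omega> k, fst (\<omega> k))) [0..<t],
      (state_at M x \<omega> t, total_cost M x \<omega> t))"

definition step_pmf ::
    "'w mdp \<Rightarrow> policy \<Rightarrow> nat \<Rightarrow> nat \<Rightarrow> (nat \<Rightarrow> nat \<times> 'w) \<Rightarrow> (nat \<times> 'w) pmf" where
  "step_pmf M \<pi> x t \<omega> =
     bind_pmf (\<pi> t (history_at M x \<omega> t))
       (\<lambda>u. map_pmf (Pair u) (trans M (state_at M x \<omega> t) u))"

abbreviation step_kernel ::
    "'w mdp \<Rightarrow> policy \<Rightarrow> nat \<Rightarrow> nat \<Rightarrow> (nat \<Rightarrow> nat \<times> 'w) \<Rightarrow> (nat \<times> 'w) measure" where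
  "step_kernel M \<pi> x t \<omega> \<equiv> measure_pmf (step_pmf M \<pi> x t \<omega>)"

text \<open>The path distribution from the Ionescu--Tulcea theorem.\<close>

definition path_measure ::
    "('w::countable) mdp \<Rightarrow> policy \<Rightarrow> nat \<Rightarrow> (nat \<Rightarrow> nat \<times> 'w) measure" where
  "path_measure M \<pi> x =
     projective_family.lim UNIV
       (Ionescu_Tulcea.CI (step_kernel M \<pi> x) (\<lambda>_. count_space UNIV)) (\<lambda>_. count_space UNIV)"

lemma Ionescu_Tulcea_step_kernel:
  fixes M :: "('w::countable) mdp"
  shows "Ionescu_Tulcea (step_kernel M \<pi> x) (\<lambda>_. count_space UNIV)"
proof
  fix t :: nat
  have "PiM {0..<t} (\<lambda>_. count_space (UNIV :: (nat \<times> 'w) set))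
          = count_space (PiE {0..<t} (\<lambda>_. UNIV))"
    by (rule count_space_PiM_finite) auto
  then show "step_kernel M \<pi> x t
      \<in> PiM {0..<t} (\<lambda>_. count_space UNIV) \<rightarrow>\<^sub>M subprob_algebra (count_space UNIV)"
    by (simp add: measure_pmf_in_subprob_algebra)
qed

definition h_d :: "nat \<Rightarrow> real" where
  "h_d x = (if x = 0 then 0 else 1)"

definition L_d :: "('w::countable) mdp \<Rightarrow> real \<Rightarrow> nat \<Rightarrow> policy \<Rightarrow> real" where
  "L_d M \<gamma> x \<pi> =
     (\<integral>\<omega>. (\<Sum>t. \<gamma> ^ t * (1 - \<gamma>) * h_d (state_at M x \<omega> t)) \<partial>path_measure M \<pi> x)"

definition feasible :: "('w::countable) mdp \<Rightarrow> real \<Rightarrow> nat \<Rightarrow> real \<Rightarrow> policy set" where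
  "feasible M \<gamma> x \<epsilon> = {\<pi> \<in> policies M. L_d M \<gamma> x \<pi> \<le> \<epsilon>}"

text \<open>The objective may be infinite, so it takes values in \<^typ>\<open>ennreal\<close>, where \<open>0 * \<infinity> = 0\<close>.\<close>

definition J_obj :: "('w::countable) mdp \<Rightarrow> nat \<Rightarrow> policy \<Rightarrow> ennreal" where
  "J_obj M x \<pi> =
     (\<integral>\<^sup>+\<omega>. indicator {\<omega>. \<exists>t. state_at M x \<omega> t = 0} \<omega> * (\<Sum>t. ennreal (cost_at M x \<omega> t))
        \<partial>path_measure M \<pi> x)"

definition J_S3P :: "('w::countable) mdp \<Rightarrow> real \<Rightarrow> nat \<Rightarrow> policy \<Rightarrow> ennreal" where
  "J_S3P M \<gamma> x \<pi> = ennreal (1 / (1 - L_d M \<gamma> x \<pi>)) * J_obj M x \<pi>"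

definition weights :: "(real \<times> real) set" where
  "weights = {(\<alpha>\<^sub>o, \<alpha>\<^sub>d). 0 \<le> \<alpha>\<^sub>o \<and> 0 \<le> \<alpha>\<^sub>d \<and> \<alpha>\<^sub>o + \<alpha>\<^sub>d = 1}"

definition J_mix ::
    "('w::countable) mdp \<Rightarrow> real \<Rightarrow> real \<Rightarrow> real \<Rightarrow> nat \<Rightarrow> real \<times> real \<Rightarrow> policy \<Rightarrow> ennreal"
  where
  "J_mix M c \<gamma> \<epsilon>' x \<alpha> \<pi> =
     ennreal (fst \<alpha>) * J_obj M x \<pi>
     + ennreal (c * (1 - \<epsilon>') / \<epsilon>' * snd \<alpha> * L_d M \<gamma> x \<pi>)"

definition J_max ::
    "('w::countable) mdp \<Rightarrow> real \<Rightarrow> real \<Rightarrow> real \<Rightarrow> nat \<Rightarrow> policy \<Rightarrow> ennreal" where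
  "J_max M c \<gamma> \<epsilon>' x \<pi> = (SUP \<alpha>\<in>weights. J_mix M c \<gamma> \<epsilon>' x \<alpha> \<pi>)"

text \<open>
  In \<^typ>\<open>ennreal\<close> the infimum of the empty set is \<open>\<infinity>\<close>.

  The multiplier \<open>c\<close> ranges over \<open>(0,\<infinity>)\<close>. With \<open>[0,\<infinity>)\<close>, the term carrying \<open>L_d\<close> would vanish
  at \<open>c = 0\<close>, so a policy that never reaches state 0 (for which \<open>J_obj\<close> is 0) would make
  \<open>cstar\<close> equal to 0, whatever the cost of the feasible policies. The choice matters only
  when the infimum of \<open>J_obj\<close> is 0; see lemma \<open>cstar_eq_closed\<close> below.
\<close>

definition cstar :: "('w::countable) mdp \<Rightarrow> real \<Rightarrow> nat \<Rightarrow> real \<Rightarrow> ennreal" where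
  "cstar M \<gamma> x \<epsilon>' =
     (INF c\<in>{c. 0 < c \<and> (INF \<pi>\<in>policies M. J_max M c \<gamma> \<epsilon>' x \<pi>) \<le> ennreal (c * (1 - \<epsilon>'))}.
        ennreal c)"

lemma cstar_eq_closed:
  assumes "(INF \<pi>\<in>policies M. J_obj M x \<pi>) \<noteq> 0"
  shows "cstar M \<gamma> x \<epsilon>' =
     (INF c\<in>{c. 0 \<le> c \<and> (INF \<pi>\<in>policies M. J_max M c \<gamma> \<epsilon>' x \<pi>) \<le> ennreal (c * (1 - \<epsilon>'))}.
        ennreal c)"
proof -
  have "J_obj M x \<pi> \<le> J_max M 0 \<gamma> \<epsilon>' x \<pi>" for \<pi>
  proof -
    have "J_mix M 0 \<gamma> \<epsilon>' x (1, 0) \<pi> \<le> J_max M 0 \<gamma> \<epsilon>' x \<pi>"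
      unfolding J_max_def by (rule SUP_upper) (simp add: weights_def)
    then show ?thesis by (simp add: J_mix_def)
  qed
  then have "(INF \<pi>\<in>policies M. J_obj M x \<pi>) \<le> (INF \<pi>\<in>policies M. J_max M 0 \<gamma> \<epsilon>' x \<pi>)"
    by (intro INF_mono) auto
  with assms have "(INF \<pi>\<in>policies M. J_max M 0 \<gamma> \<epsilon>' x \<pi>) \<noteq> 0"
    by auto
  then have "{c. 0 \<le> c \<and> (INF \<pi>\<in>policies M. J_max M c \<gamma> \<epsilon>' x \<pi>) \<le> ennreal (c * (1 - \<epsilon>'))}
      = {c. 0 < c \<and> (INF \<pi>\<in>policies M. J_max M c \<gamma> \<epsilon>' x \<pi>) \<le> ennreal (c * (1 - \<epsilon>'))}"
    by (auto simp: order_le_less)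
  then show ?thesis unfolding cstar_def by simp
qed

end

theory Submission
  imports Defs "HOL-Library.Diagonal_Subsequence"
begin

text \<open>
  For \<open>\<epsilon>' \<in> (0, 1)\<close> the maximum over the weights is \<open>max J (c (1 - \<epsilon>') / \<epsilon>' * L)\<close>, which is at
  most \<open>c (1 - \<epsilon>')\<close> iff \<open>J \<le> c (1 - \<epsilon>')\<close> and \<open>L \<le> \<epsilon>'\<close>. Hence \<open>c\<^sup>*(\<epsilon>')\<close> is the minimum
  of \<open>J / (1 - \<epsilon>')\<close> over the policies with \<open>L \<le> \<epsilon>'\<close>; minimizing over \<open>\<epsilon>'\<close> as well, the best choice
  for a given policy is \<open>\<epsilon>' = L\<close>, which yields \<open>J / (1 - L)\<close>.

  All the minima are attained because the set of policies is sequentially compact and both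
  \<open>J\<close> and \<open>L\<close> are lower semicontinuous: each is a supremum of integrals of nonnegative functions
  of finite prefixes of a path, to which Fatou's lemma applies step by step.
\<close>

section \<open>Functions of finite prefixes of a path\<close>

text \<open>The condition is put on whole paths, not on elements of a finite product, so that one
  \<open>F\<close> can be integrated both against the path measure and against its finite
  marginals.\<close>

definition prefix_determined :: "nat \<Rightarrow> ((nat \<Rightarrow> 'a) \<Rightarrow> 'b) \<Rightarrow> bool" where
  "prefix_determined t F \<longleftrightarrow> (\<forall>\<omega> \<omega>'. (\<forall>k<t. \<omega> k = \<omega>' k) \<longrightarrow> F \<omega> = F \<omega>')"

lemma prefix_determinedD:
  "prefix_determined t F \<Longrightarrow> (\<And>k. k < t \<Longrightarrow> \<omega> k = \<omega>' k) \<Longrightarrow> F \<omega> = F \<omega>'"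
  by (auto simp: prefix_determined_def)

lemma prefix_determined_restrict:
  "prefix_determined t F \<Longrightarrow> F (restrict \<omega> {0..<t}) = F \<omega>"
  by (erule prefix_determinedD) auto

lemma prefix_determined_compose:
  "prefix_determined t F \<Longrightarrow> prefix_determined t (\<lambda>\<omega>. f (F \<omega>))"
  unfolding prefix_determined_def by metis

lemma prefix_determined_compose2:
  "prefix_determined t F \<Longrightarrow> prefix_determined t G \<Longrightarrow> prefix_determined t (\<lambda>\<omega>. f (F \<omega>) (G \<omega>))"
  unfolding prefix_determined_def by metis

lemma prefix_determined_sum:
  fixes F :: "nat \<Rightarrow> (nat \<Rightarrow> 'a) \<Rightarrow> 'b :: comm_monoid_add"
  shows "(\<And>k. k \<in> I \<Longrightarrow> prefix_determined t (F k)) \<Longrightarrow> prefix_determined t (\<lambda>\<omega>. \<Sum>k\<in>I. F k \<omega>)"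
  unfolding prefix_determined_def by (intro allI impI sum.cong) auto

text \<open>A finite product of countable discrete spaces is again discrete, and \<open>F\<close>
  factors through restriction to \<open>{0..<t}\<close>; measurability is therefore automatic for
  any codomain.\<close>

lemma measurable_prefix_determined:
  fixes F :: "(nat \<Rightarrow> 'a::countable) \<Rightarrow> 'b"
  assumes "prefix_determined t F"
  shows "F \<in> PiM UNIV (\<lambda>_. count_space UNIV) \<rightarrow>\<^sub>M count_space UNIV"
proof -
  have "PiM {0..<t} (\<lambda>_. count_space (UNIV :: 'a set)) = count_space (PiE {0..<t} (\<lambda>_. UNIV))"
    by (rule count_space_PiM_finite) auto
  then have "F \<in> PiM {0..<t} (\<lambda>_. count_space (UNIV :: 'a set)) \<rightarrow>\<^sub>M count_space UNIV"
    by simp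
  then have "(\<lambda>\<omega>. F (restrict \<omega> {0..<t})) \<in> PiM UNIV (\<lambda>_. count_space UNIV) \<rightarrow>\<^sub>M count_space UNIV"
    by (rule measurable_compose[OF measurable_restrict_subset, rotated]) simp
  then show ?thesis
    by (simp only: prefix_determined_restrict[OF assms])
qed

lemma state_at_cong: "(\<And>k. k < t \<Longrightarrow> \<omega> k = \<omega>' k) \<Longrightarrow> state_at M x \<omega> t = state_at M x \<omega>' t"
  by (induction t) auto

lemma prefix_determined_state_at: "t \<le> T \<Longrightarrow> prefix_determined T (\<lambda>\<omega>. state_at M x \<omega> t)"
  unfolding prefix_determined_def by (auto intro!: state_at_cong)

lemma prefix_determined_cost_at: "t < T \<Longrightarrow> prefix_determined T (\<lambda>\<omega>. cost_at M x \<omega> t)"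
  unfolding prefix_determined_def cost_at_def
  using state_at_cong[of t] by (metis order.strict_trans)

lemma prefix_determined_total_cost: "t \<le> T \<Longrightarrow> prefix_determined T (\<lambda>\<omega>. total_cost M x \<omega> t)"
  unfolding total_cost_def by (intro prefix_determined_sum prefix_determined_cost_at) auto

lemma history_at_cong:
  assumes "\<And>k. k < t \<Longrightarrow> \<omega> k = \<omega>' k"
  shows "history_at M x \<omega> t = history_at M x \<omega>' t"
proof -
  have "state_at M x \<omega> k = state_at M x \<omega>' k" "total_cost M x \<omega> k = total_cost M x \<omega>' k"
    if "k \<le> t" for k
    using that assms prefix_determined_state_at[of k t M x] prefix_determined_total_cost[of k t M x]
    by (auto simp: prefix_determined_def)
  with assms show ?thesis by (auto simp: history_at_def)
qed

lemma step_pmf_cong: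
  "(\<And>k. k < t \<Longrightarrow> \<omega> k = \<omega>' k) \<Longrightarrow> step_pmf M \<pi> x t \<omega> = step_pmf M \<pi> x t \<omega>'"
  using history_at_cong[of t \<omega> \<omega>'] state_at_cong[of t \<omega> \<omega>']
  unfolding step_pmf_def by simp

text \<open>Integrating out coordinate \<open>t\<close> removes the dependence on it, and the kernel
  at time \<open>t\<close> itself looks only at earlier coordinates. This keeps an induction on the
  prefix length inside the class.\<close>

lemma prefix_determined_step:
  fixes F :: "(nat \<Rightarrow> nat \<times> 'w) \<Rightarrow> ennreal"
  assumes F: "prefix_determined (Suc t) F"
  shows "prefix_determined t (\<lambda>\<omega>. \<integral>\<^sup>+a. F (fun_upd \<omega> t a) \<partial>step_pmf M \<pi> x t \<omega>)"
  unfolding prefix_determined_def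
proof (intro allI impI)
  fix \<omega> \<omega>' :: "nat \<Rightarrow> nat \<times> 'w"
  assume eq: "\<forall>k<t. \<omega> k = \<omega>' k"
  then have "F (fun_upd \<omega> t a) = F (fun_upd \<omega>' t a)" for a
    by (intro prefix_determinedD[OF F]) auto
  moreover have "step_pmf M \<pi> x t \<omega> = step_pmf M \<pi> x t \<omega>'"
    using eq by (intro step_pmf_cong) auto
  ultimately show "(\<integral>\<^sup>+a. F (fun_upd \<omega> t a) \<partial>step_pmf M \<pi> x t \<omega>)
      = (\<integral>\<^sup>+a. F (fun_upd \<omega>' t a) \<partial>step_pmf M \<pi> x t \<omega>')"
    by simp
qed

section \<open>The path measure\<close>

context
  fixes M :: "('w::countable) mdp" and \<pi> :: policy and x :: nat
begin

interpretation IT: Ionescu_Tulcea "step_kernel M \<pi> x" "\<lambda>_. count_space UNIV"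
  by (rule Ionescu_Tulcea_step_kernel)

lemma space_path_measure [simp]: "space (path_measure M \<pi> x) = UNIV"
  by (simp add: path_measure_def space_PiM PiE_UNIV_domain)

lemma sets_path_measure [measurable_cong]:
  "sets (path_measure M \<pi> x) = sets (PiM UNIV (\<lambda>_. count_space UNIV))"
  by (simp add: path_measure_def)

lemma borel_measurable_path:
  "prefix_determined t F \<Longrightarrow> F \<in> borel_measurable (path_measure M \<pi> x)"
  using measurable_compose[OF measurable_prefix_determined[of t F], of "\<lambda>x. x" borel]
  by (simp add: measurable_cong_sets[OF sets_path_measure refl])

text \<open>The marginal of the projective limit on \<open>{0..<t}\<close> is the law
  \<open>C 0 t\<close> obtained by composing the first \<open>t\<close> kernels.\<close>

lemma nn_integral_path_prefix:
  assumes F: "prefix_determined t (F :: _ \<Rightarrow> ennreal)"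
  shows "(\<integral>\<^sup>+\<omega>. F \<omega> \<partial>path_measure M \<pi> x) = (\<integral>\<^sup>+\<omega>. F \<omega> \<partial>IT.C 0 t (\<lambda>_. undefined))"
proof -
  let ?M = "\<lambda>_::nat. count_space (UNIV :: (nat \<times> 'w) set)"
  have 0: "(\<lambda>_. undefined) \<in> space (PiM {0..<0} ?M)"
    by (simp add: space_PiM)
  have "PiM {0..<t} ?M = count_space (PiE {0..<t} (\<lambda>_. UNIV))"
    by (rule count_space_PiM_finite) auto
  then have meas: "F \<in> borel_measurable (PiM {0..<t} ?M)"
    by simp
  \<comment> \<open>\<open>CI J\<close> runs the kernels up to the least time from which
    \<open>J\<close> has no elements and then restricts to \<open>J\<close>, so this time has to be
    identified as \<open>t\<close>.\<close>
  have up: "IT.up_to {0..<t} \<le> t"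
    by (simp add: IT.up_to_iff)
  moreover have "t \<le> IT.up_to {0..<t}"
  proof (rule ccontr)
    assume "\<not> ?thesis"
    then show False using IT.up_to_less[of "{0..<t}" "IT.up_to {0..<t}"] by simp
  qed
  ultimately have up: "IT.up_to {0..<t} = t" by simp
  have "(\<integral>\<^sup>+\<omega>. F \<omega> \<partial>path_measure M \<pi> x) = (\<integral>\<^sup>+\<omega>. F (restrict \<omega> {0..<t}) \<partial>IT.PF.lim)"
    by (simp only: prefix_determined_restrict[OF F] path_measure_def)
  also have "\<dots> = (\<integral>\<^sup>+\<omega>. F \<omega> \<partial>distr IT.PF.lim (PiM {0..<t} ?M) (\<lambda>\<omega>. restrict \<omega> {0..<t}))"
    by (subst nn_integral_distr)
       (auto simp: measurable_cong_sets[OF IT.PF.sets_lim refl] meas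
          intro!: measurable_restrict_subset)
  also have "distr IT.PF.lim (PiM {0..<t} ?M) (\<lambda>\<omega>. restrict \<omega> {0..<t}) = IT.CI {0..<t}"
    by (rule IT.distr_lim) simp
  also have "\<dots> = distr (IT.C 0 t (\<lambda>_. undefined)) (PiM {0..<t} ?M) (\<lambda>\<omega>. restrict \<omega> {0..<t})"
    unfolding IT.CI_def up ..
  also have "\<dots> = IT.C 0 t (\<lambda>_. undefined)"
    using IT.distr_C[of t t "\<lambda>_. undefined" 0] 0 by simp
  finally show ?thesis .
qed

lemma prob_space_path_measure: "prob_space (path_measure M \<pi> x)"
proof
  have 0: "(\<lambda>_. undefined) \<in> space (PiM {0..<0} (\<lambda>_::nat. count_space (UNIV :: (nat \<times> 'w) set)))"
    by (simp add: space_PiM)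
  have "(\<integral>\<^sup>+\<omega>. 1 \<partial>path_measure M \<pi> x) = (\<integral>\<^sup>+\<omega>. 1 \<partial>IT.C 0 0 (\<lambda>_. undefined))"
    by (rule nn_integral_path_prefix) (simp add: prefix_determined_def)
  then show "emeasure (path_measure M \<pi> x) (space (path_measure M \<pi> x)) = 1"
    using prob_space.emeasure_space_1[OF IT.prob_space_C[OF 0, of 0]] by simp
qed

text \<open>One-step disintegration: \<open>C 0 (Suc t)\<close> is \<open>C 0 t\<close> bound with
  the kernel at time \<open>t\<close>. The outer integral is again over the full path measure, the
  form that the induction for lower semicontinuity needs.\<close>

lemma nn_integral_path_Suc:
  assumes F: "prefix_determined (Suc t) (F :: _ \<Rightarrow> ennreal)"
  shows "(\<integral>\<^sup>+\<omega>. F \<omega> \<partial>path_measure M \<pi> x)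
    = (\<integral>\<^sup>+\<omega>. \<integral>\<^sup>+a. F (fun_upd \<omega> t a) \<partial>step_pmf M \<pi> x t \<omega> \<partial>path_measure M \<pi> x)"
proof -
  let ?M = "\<lambda>_::nat. count_space (UNIV :: (nat \<times> 'w) set)"
  have 0: "(\<lambda>_. undefined) \<in> space (PiM {0..<0} ?M)"
    by (simp add: space_PiM)
  have "PiM {0..<Suc t} ?M = count_space (PiE {0..<Suc t} (\<lambda>_. UNIV))"
    by (rule count_space_PiM_finite) auto
  then have meas: "F \<in> borel_measurable (PiM {0..<Suc t} ?M)"
    by simp
  note * = nn_integral_path_prefix[OF prefix_determined_step[OF F]]
  have "(\<integral>\<^sup>+\<omega>. F \<omega> \<partial>IT.C 0 (Suc t) (\<lambda>_. undefined))
      = (\<integral>\<^sup>+\<omega>. \<integral>\<^sup>+\<omega>'. F \<omega>' \<partial>IT.eP t \<omega> \<partial>IT.C 0 t (\<lambda>_. undefined))"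
    using IT.measurable_eP[of t] IT.sets_C[OF 0, of t]
    by (simp add: nn_integral_bind[OF meas] cong: measurable_cong_sets)
  also have "\<dots> = (\<integral>\<^sup>+\<omega>. \<integral>\<^sup>+a. F (fun_upd \<omega> t a) \<partial>step_pmf M \<pi> x t \<omega> \<partial>IT.C 0 t (\<lambda>_. undefined))"
    by (intro nn_integral_cong IT.nn_integral_eP meas) (simp add: IT.space_C[OF 0])
  finally show ?thesis
    by (simp only: * nn_integral_path_prefix[OF F])
qed

end

section \<open>Compactness of the set of policies\<close>

text \<open>Cantor's diagonal argument: Bolzano-Weierstrass refines the subsequence for one index
  after another, and countability of the index type lets a single sequence serve all.\<close>

lemma diagonal_convergent_subseq:
  fixes f :: "nat \<Rightarrow> 'i::countable \<Rightarrow> real"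
  assumes "\<And>i. bounded (range (\<lambda>n. f n i))"
  obtains s :: "nat \<Rightarrow> nat" where "strict_mono s" "\<And>i. convergent (\<lambda>n. f (s n) i)"
proof -
  interpret subseqs "\<lambda>k s. convergent (\<lambda>n. f (s n) (from_nat k))"
  proof
    fix k and s :: "nat \<Rightarrow> nat"
    have "bounded (range (\<lambda>n. f (s n) (from_nat k)))"
      by (rule bounded_subset[OF assms[of "from_nat k"]]) auto
    from bounded_imp_convergent_subsequence[OF this] obtain l r where
      "strict_mono (r :: nat \<Rightarrow> nat)" "((\<lambda>n. f (s n) (from_nat k)) \<circ> r) \<longlonglongrightarrow> l"
      by blast
    then show "\<exists>r. strict_mono r \<and> convergent (\<lambda>n. f ((s \<circ> r) n) (from_nat k))"
      by (auto simp: convergent_def o_def)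
  qed
  have "convergent (\<lambda>n. f (diagseq n) i)" for i
  proof -
    \<comment> \<open>From position \<open>Suc k\<close> on, the diagonal sequence is a subsequence
      of the one refined for index \<open>k\<close>; the finitely many earlier terms do not affect
      convergence.\<close>
    have "convergent (\<lambda>n. f ((diagseq \<circ> ((+) (Suc (to_nat i)))) n) (from_nat (to_nat i)))"
      using convergent_subseq_convergent
      by (intro diagseq_holds) (auto simp: o_def)
    then have "convergent (\<lambda>n. f (diagseq (n + Suc (to_nat i))) i)"
      by (simp add: o_def add_ac)
    then show ?thesis
      by (rule convergent_ignore_initial_segment[THEN iffD1])
  qed
  with subseq_diagseq show thesis by (rule that)
qed

text \<open>No mass escapes, because all supports lie in one finite set: the sum over
  \<open>A\<close> passes to the limit and stays 1.\<close>

lemma pmf_limit_exists: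
  assumes A: "finite A" "\<And>n. set_pmf (p n) \<subseteq> A"
    and conv: "\<And>u. convergent (\<lambda>n. pmf (p n) u)"
  shows "\<exists>q. set_pmf q \<subseteq> A \<and> (\<forall>u. (\<lambda>n. pmf (p n) u) \<longlonglongrightarrow> pmf q u)"
proof -
  define f where "f u = lim (\<lambda>n. pmf (p n) u)" for u
  have f: "(\<lambda>n. pmf (p n) u) \<longlonglongrightarrow> f u" for u
    using conv unfolding f_def by (simp add: convergent_LIMSEQ_iff)
  have nonneg: "0 \<le> f u" for u
    by (rule LIMSEQ_le_const[OF f]) auto
  have outside: "f u = 0" if "u \<notin> A" for u
  proof -
    have "pmf (p n) u = 0" for n
      using A(2)[of n] that by (auto simp: set_pmf_iff)
    then show ?thesis using f[of u] by (simp add: LIMSEQ_const_iff)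
  qed
  have "(\<lambda>n. \<Sum>u\<in>A. pmf (p n) u) \<longlonglongrightarrow> (\<Sum>u\<in>A. f u)"
    by (intro tendsto_sum f)
  then have sum: "(\<Sum>u\<in>A. f u) = 1"
    using sum_pmf_eq_1[OF A(1) A(2)] by (simp add: LIMSEQ_const_iff)
  have "(\<integral>\<^sup>+u. ennreal (f u) \<partial>count_space UNIV) = (\<Sum>u\<in>A. ennreal (f u))"
    using A(1) outside by (intro nn_integral_count_space') auto
  also have "\<dots> = 1"
    using sum nonneg by simp
  finally have "pmf (embed_pmf f) u = f u" for u
    using nonneg by (simp add: pmf_embed_pmf)
  then show ?thesis
    using f outside by (intro exI[of _ "embed_pmf f"]) (force simp: set_pmf_iff)
qed

text \<open>Only countably many histories can occur, because \<^const>\<open>history_at\<close> depends on the first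
  \<open>t\<close> pairs of a path only; hence a diagonal sequence suffices.\<close>

lemma policies_subseq_limit:
  fixes M :: "('w::countable) mdp" and x :: nat
  assumes "\<And>n. \<sigma> n \<in> policies M"
  obtains s :: "nat \<Rightarrow> nat" and \<pi> where "strict_mono s" "\<pi> \<in> policies M"
    "\<And>t \<omega> u. (\<lambda>n. pmf (\<sigma> (s n) t (history_at M x \<omega> t)) u) \<longlonglongrightarrow> pmf (\<pi> t (history_at M x \<omega> t)) u"
proof -
  \<comment> \<open>A list \<open>l\<close> stands for a finite prefix of a path, which makes the
    set of indices \<open>(t, l, u)\<close> countable. Values of \<open>(!) l\<close> past the end
    are irrelevant once \<open>l\<close> has length \<open>t\<close>.\<close>
  define f where
    "f n = (\<lambda>(t, l, u). pmf (\<sigma> n t (history_at M x ((!) l) t)) u)" for n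
  have "bounded (range (\<lambda>n. f n i))" for i
    by (cases i) (auto simp: f_def bounded_iff pmf_le_1 intro!: exI[of _ 1])
  then obtain s :: "nat \<Rightarrow> nat" where s: "strict_mono s" "\<And>i. convergent (\<lambda>n. f (s n) i)"
    using diagonal_convergent_subseq[of f] by blast
  have conv: "convergent (\<lambda>n. pmf (\<sigma> (s n) t (history_at M x \<omega> t)) u)" for t \<omega> u
  proof -
    have "history_at M x ((!) (map \<omega> [0..<t])) t = history_at M x \<omega> t"
      by (rule history_at_cong) simp
    then show ?thesis
      using s(2)[of "(t, map \<omega> [0..<t], u)"] by (simp add: f_def)
  qed
  \<comment> \<open>Histories outside the range of \<open>history_at M x\<close> need not have
    convergent action probabilities; there \<open>\<sigma> 0\<close> is the witness, so that the
    limit is a policy at every history.\<close>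
  have "\<exists>q. set_pmf q \<subseteq> actions M \<and>
      ((\<forall>u. convergent (\<lambda>n. pmf (\<sigma> (s n) t H) u)) \<longrightarrow> (\<forall>u. (\<lambda>n. pmf (\<sigma> (s n) t H) u) \<longlonglongrightarrow> pmf q u))"
    for t H
  proof (cases "\<forall>u. convergent (\<lambda>n. pmf (\<sigma> (s n) t H) u)")
    case True
    moreover have "finite (actions M)" "\<And>n. set_pmf (\<sigma> (s n) t H) \<subseteq> actions M"
      using assms by (simp add: actions_def, unfold policies_def, blast)
    ultimately show ?thesis
      using pmf_limit_exists[of "actions M" "\<lambda>n. \<sigma> (s n) t H"] by blast
  next
    case False
    then show ?thesis
      using assms[of 0] unfolding policies_def by blast
  qed
  then obtain \<pi> where \<pi>: "\<And>t H. set_pmf (\<pi> t H) \<subseteq> actions M"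
    "\<And>t H u. (\<And>u. convergent (\<lambda>n. pmf (\<sigma> (s n) t H) u)) \<Longrightarrow>
       (\<lambda>n. pmf (\<sigma> (s n) t H) u) \<longlonglongrightarrow> pmf (\<pi> t H) u"
    by metis
  show thesis
    by (rule that[OF s(1), of \<pi>]) (use \<pi> conv in \<open>auto simp: policies_def\<close>)
qed

section \<open>Lower semicontinuity\<close>

text \<open>Fatou's lemma for the counting measure, applied to the densities times
  \<open>F\<close>.\<close>

lemma nn_integral_pmf_lsc:
  assumes "\<And>u. (\<lambda>n. pmf (p n) u) \<longlonglongrightarrow> pmf q u"
  shows "(\<integral>\<^sup>+u. F u \<partial>measure_pmf q) \<le> liminf (\<lambda>n. \<integral>\<^sup>+u. F u \<partial>measure_pmf (p n))"
proof -
  have "ennreal (pmf q u) * F u \<le> liminf (\<lambda>n. ennreal (pmf (p n) u) * F u)" for u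
  \<comment> \<open>Where the limit has no mass and \<open>F u\<close> is infinite, the product need
    not converge to 0, but 0 is a lower bound anyway.\<close>
  proof (cases "pmf q u = 0")
    case False
    then have "(\<lambda>n. ennreal (pmf (p n) u) * F u) \<longlonglongrightarrow> ennreal (pmf q u) * F u"
      using assms[of u]
      by (intro tendsto_mult_ennreal tendsto_ennrealI tendsto_const) (auto simp: ennreal_eq_0_iff)
    then show ?thesis
      by (simp add: lim_imp_Liminf)
  qed simp
  then have "(\<integral>\<^sup>+u. F u \<partial>measure_pmf q)
      \<le> (\<integral>\<^sup>+u. liminf (\<lambda>n. ennreal (pmf (p n) u) * F u) \<partial>count_space UNIV)"
    unfolding nn_integral_measure_pmf by (intro nn_integral_mono)
  also have "\<dots> \<le> liminf (\<lambda>n. \<integral>\<^sup>+u. ennreal (pmf (p n) u) * F u \<partial>count_space UNIV)"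
    by (rule nn_integral_liminf) simp
  finally show ?thesis
    by (simp add: nn_integral_measure_pmf)
qed

context
  fixes M :: "('w::countable) mdp" and x :: nat and \<sigma> :: "nat \<Rightarrow> policy" and \<pi> :: policy
  assumes lim: "\<And>t \<omega> u. (\<lambda>n. pmf (\<sigma> n t (history_at M x \<omega> t)) u) \<longlonglongrightarrow> pmf (\<pi> t (history_at M x \<omega> t)) u"
begin

text \<open>The measure and the one-step integral \<open>G\<close> both vary with the policy.
  Freezing the integrand at \<open>H N\<close>, an infimum over \<open>n \<ge> N\<close>, separates
  the two: the induction hypothesis treats the measure, monotone convergence the limit in
  \<open>N\<close>.\<close>

lemma nn_integral_path_prefix_lsc:
  assumes "prefix_determined t (F :: _ \<Rightarrow> ennreal)"
  shows "(\<integral>\<^sup>+\<omega>. F \<omega> \<partial>path_measure M \<pi> x) \<le> liminf (\<lambda>n. \<integral>\<^sup>+\<omega>. F \<omega> \<partial>path_measure M (\<sigma> n) x)"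
  using assms
proof (induction t arbitrary: F)
  case 0
  then have "F = (\<lambda>_. F undefined)"
    by (auto simp: prefix_determined_def)
  moreover have "(\<integral>\<^sup>+\<omega>. c \<partial>path_measure M \<rho> x) = c" for c :: ennreal and \<rho>
    using prob_space.emeasure_space_1[OF prob_space_path_measure[of M \<rho> x]] by simp
  ultimately have "(\<integral>\<^sup>+\<omega>. F \<omega> \<partial>path_measure M \<rho> x) = F undefined" for \<rho>
    by metis
  then show ?case by (simp add: Liminf_const)
next
  case (Suc t)
  define G where "G \<rho> \<omega> = (\<integral>\<^sup>+a. F (fun_upd \<omega> t a) \<partial>step_pmf M \<rho> x t \<omega>)" for \<rho> \<omega>
  define H where "H N \<omega> = (INF n\<in>{N..}. G (\<sigma> n) \<omega>)" for N \<omega>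
  have G_pd: "prefix_determined t (G \<rho>)" for \<rho>
    unfolding G_def by (rule prefix_determined_step[OF Suc.prems])
  have H_pd: "prefix_determined t (H N)" for N
    unfolding prefix_determined_def H_def
    by (intro allI impI INF_cong refl prefix_determinedD[OF G_pd]) auto
  \<comment> \<open>Given the action, the law of the disturbance is the same for every policy, so
    only the action probabilities move.\<close>
  have "G \<pi> \<omega> \<le> liminf (\<lambda>n. G (\<sigma> n) \<omega>)" for \<omega>
    unfolding G_def step_pmf_def nn_integral_bind_pmf
    by (rule nn_integral_pmf_lsc) (rule lim)
  then have GH: "G \<pi> \<omega> \<le> (SUP N. H N \<omega>)" for \<omega>
    by (simp add: liminf_SUP_INF H_def)
  have "(\<integral>\<^sup>+\<omega>. F \<omega> \<partial>path_measure M \<pi> x) = (\<integral>\<^sup>+\<omega>. G \<pi> \<omega> \<partial>path_measure M \<pi> x)"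
    unfolding G_def by (rule nn_integral_path_Suc[OF Suc.prems])
  also have "\<dots> \<le> (\<integral>\<^sup>+\<omega>. (SUP N. H N \<omega>) \<partial>path_measure M \<pi> x)"
    by (intro nn_integral_mono GH)
  also have "\<dots> = (SUP N. \<integral>\<^sup>+\<omega>. H N \<omega> \<partial>path_measure M \<pi> x)"
    by (intro nn_integral_monotone_convergence_SUP borel_measurable_path[OF H_pd])
       (auto simp: incseq_def le_fun_def H_def intro!: INF_superset_mono)
  also have "\<dots> \<le> liminf (\<lambda>n. \<integral>\<^sup>+\<omega>. F \<omega> \<partial>path_measure M (\<sigma> n) x)"
  proof (rule SUP_least)
    fix N
    have "(\<integral>\<^sup>+\<omega>. H N \<omega> \<partial>path_measure M (\<sigma> n) x) \<le> (\<integral>\<^sup>+\<omega>. F \<omega> \<partial>path_measure M (\<sigma> n) x)"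
      if "N \<le> n" for n
      unfolding nn_integral_path_Suc[OF Suc.prems] G_def[symmetric]
      using that by (intro nn_integral_mono) (auto simp: H_def intro: INF_lower)
    then have "liminf (\<lambda>n. \<integral>\<^sup>+\<omega>. H N \<omega> \<partial>path_measure M (\<sigma> n) x)
        \<le> liminf (\<lambda>n. \<integral>\<^sup>+\<omega>. F \<omega> \<partial>path_measure M (\<sigma> n) x)"
      by (intro Liminf_mono) (auto simp: eventually_sequentially)
    with Suc.IH[OF H_pd[of N]] show "(\<integral>\<^sup>+\<omega>. H N \<omega> \<partial>path_measure M \<pi> x)
        \<le> liminf (\<lambda>n. \<integral>\<^sup>+\<omega>. F \<omega> \<partial>path_measure M (\<sigma> n) x)"
      by (rule order_trans)
  qed
  finally show ?case .
qed

text \<open>A supremum of lower semicontinuous functionals is lower semicontinuous; monotone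
  convergence moves the supremum outside the integral.\<close>

lemma nn_integral_path_lsc:
  fixes F :: "nat \<Rightarrow> (nat \<Rightarrow> nat \<times> 'w) \<Rightarrow> ennreal"
  assumes "\<And>T. prefix_determined T (F T)" and "incseq F"
  shows "(\<integral>\<^sup>+\<omega>. (SUP T. F T \<omega>) \<partial>path_measure M \<pi> x)
    \<le> liminf (\<lambda>n. \<integral>\<^sup>+\<omega>. (SUP T. F T \<omega>) \<partial>path_measure M (\<sigma> n) x)"
proof -
  have "(\<integral>\<^sup>+\<omega>. (SUP T. F T \<omega>) \<partial>path_measure M \<pi> x) = (SUP T. \<integral>\<^sup>+\<omega>. F T \<omega> \<partial>path_measure M \<pi> x)"
    by (intro nn_integral_monotone_convergence_SUP assms(2) borel_measurable_path[OF assms(1)])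
  also have "\<dots> \<le> liminf (\<lambda>n. \<integral>\<^sup>+\<omega>. (SUP T. F T \<omega>) \<partial>path_measure M (\<sigma> n) x)"
  proof (rule SUP_least)
    fix T
    show "(\<integral>\<^sup>+\<omega>. F T \<omega> \<partial>path_measure M \<pi> x)
      \<le> liminf (\<lambda>n. \<integral>\<^sup>+\<omega>. (SUP T. F T \<omega>) \<partial>path_measure M (\<sigma> n) x)"
      by (rule order_trans[OF nn_integral_path_prefix_lsc[OF assms(1)]])
         (intro Liminf_mono always_eventually allI nn_integral_mono SUP_upper UNIV_I)
  qed
  finally show ?thesis .
qed

end

section \<open>The two criteria\<close>

text \<open>Everything compares with a geometric series of total mass 1. The last bound keeps only
  the term \<open>t = 0\<close> and yields positivity of \<open>L_d\<close> away from the terminal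
  state.\<close>

lemma L_d_integrand_bounds:
  assumes "0 < \<gamma>" "\<gamma> < 1"
  shows "summable (\<lambda>t. \<gamma> ^ t * (1 - \<gamma>) * h_d (y t))"
    and "0 \<le> (\<Sum>t. \<gamma> ^ t * (1 - \<gamma>) * h_d (y t))"
    and "(\<Sum>t. \<gamma> ^ t * (1 - \<gamma>) * h_d (y t)) \<le> 1"
    and "(1 - \<gamma>) * h_d (y 0) \<le> (\<Sum>t. \<gamma> ^ t * (1 - \<gamma>) * h_d (y t))"
proof -
  let ?a = "\<lambda>t. \<gamma> ^ t * (1 - \<gamma>) * h_d (y t)"
  have nonneg: "0 \<le> ?a t" for t
    using assms by (simp add: h_d_def)
  have le: "?a t \<le> \<gamma> ^ t * (1 - \<gamma>)" for t
    using assms by (simp add: h_d_def)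
  have geo: "(\<lambda>t. \<gamma> ^ t * (1 - \<gamma>)) sums 1"
    using sums_mult2[OF geometric_sums[of \<gamma>], of "1 - \<gamma>"] assms by simp
  show summ: "summable ?a"
    by (rule summable_comparison_test'[OF sums_summable[OF geo], of 0]) (use nonneg le in auto)
  show "0 \<le> suminf ?a"
    by (rule suminf_nonneg[OF summ nonneg])
  show "suminf ?a \<le> 1"
    using suminf_le[OF le summ sums_summable[OF geo]] sums_unique[OF geo] by simp
  show "(1 - \<gamma>) * h_d (y 0) \<le> suminf ?a"
    using sum_le_suminf[OF summ, of "{0}"] nonneg by simp
qed

context
  fixes M :: "('w::countable) mdp" and x :: nat and \<gamma> :: real
  assumes \<gamma>: "0 < \<gamma>" "\<gamma> < 1"
begin

abbreviation (input) discounted_h :: "(nat \<Rightarrow> nat \<times> 'w) \<Rightarrow> nat \<Rightarrow> real" where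
  "discounted_h \<omega> t \<equiv> \<gamma> ^ t * (1 - \<gamma>) * h_d (state_at M x \<omega> t)"

lemma discounted_h_integrable:
  "integrable (path_measure M \<pi> x) (\<lambda>\<omega>. \<Sum>t. discounted_h \<omega> t)"
proof -
  interpret prob_space "path_measure M \<pi> x"
    by (rule prob_space_path_measure)
  have "(\<lambda>\<omega>. discounted_h \<omega> t) \<in> borel_measurable (path_measure M \<pi> x)" for t
    by (rule borel_measurable_path[of t])
       (rule prefix_determined_compose[OF prefix_determined_state_at[OF order_refl]])
  then have "(\<lambda>\<omega>. \<Sum>t. discounted_h \<omega> t) \<in> borel_measurable (path_measure M \<pi> x)"
    by (rule borel_measurable_suminf)
  then show ?thesis
    using L_d_integrand_bounds[OF \<gamma>] by (intro integrable_const_bound[of _ 1]) auto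
qed

lemma L_d_nonneg: "0 \<le> L_d M \<gamma> x \<pi>"
  unfolding L_d_def using L_d_integrand_bounds(2)[OF \<gamma>] by simp

lemma L_d_le_1: "L_d M \<gamma> x \<pi> \<le> 1"
  unfolding L_d_def
  using prob_space.integral_le_const[OF prob_space_path_measure discounted_h_integrable]
    L_d_integrand_bounds(3)[OF \<gamma>] by simp

lemma L_d_pos:
  assumes "x \<noteq> 0"
  shows "0 < L_d M \<gamma> x \<pi>"
proof -
  have "1 - \<gamma> \<le> (\<Sum>t. discounted_h \<omega> t)" for \<omega>
    using L_d_integrand_bounds(4)[OF \<gamma>, of "state_at M x \<omega>"] assms by (simp add: h_d_def)
  then have "1 - \<gamma> \<le> L_d M \<gamma> x \<pi>"
    unfolding L_d_def
    using prob_space.integral_ge_const[OF prob_space_path_measure discounted_h_integrable] by simp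
  then show ?thesis using \<gamma> by simp
qed

text \<open>Brings \<open>L_d\<close> into the form of an integrated increasing supremum of prefix
  functions, to which \<open>nn_integral_path_lsc\<close> applies.\<close>

lemma ennreal_L_d:
  "ennreal (L_d M \<gamma> x \<pi>) = (\<integral>\<^sup>+\<omega>. (SUP T. \<Sum>t<T. ennreal (discounted_h \<omega> t)) \<partial>path_measure M \<pi> x)"
proof -
  have "(SUP T. \<Sum>t<T. ennreal (discounted_h \<omega> t)) = ennreal (\<Sum>t. discounted_h \<omega> t)" for \<omega>
    using \<gamma> L_d_integrand_bounds(1)[OF \<gamma>]
    by (subst suminf_eq_SUP[symmetric], intro suminf_ennreal2) (auto simp: h_d_def)
  then show ?thesis
    unfolding L_d_def
    using nn_integral_eq_integral[OF discounted_h_integrable] L_d_integrand_bounds(2)[OF \<gamma>] by simp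
qed

end

text \<open>Reaching 0 by time \<open>T\<close> and the costs before \<open>T\<close> are both
  determined by the first \<open>T\<close> pairs, so truncating indicator and sum together gives an
  increasing sequence of prefix functions.\<close>

lemma J_obj_SUP:
  "J_obj M x \<pi> = (\<integral>\<^sup>+\<omega>. (SUP T. indicator {\<omega>. \<exists>t\<le>T. state_at M x \<omega> t = 0} \<omega>
      * (\<Sum>t<T. ennreal (cost_at M x \<omega> t))) \<partial>path_measure M \<pi> x)"
  unfolding J_obj_def
proof (intro nn_integral_cong)
  fix \<omega>
  let ?I = "\<lambda>T. indicator {\<omega>. \<exists>t\<le>T. state_at M x \<omega> t = 0} \<omega> :: ennreal"
  let ?S = "\<lambda>T. \<Sum>t<T. ennreal (cost_at M x \<omega> t)"
  have "(SUP T. ?I T * ?S T) = (SUP T. ?I T) * (SUP T. ?S T)"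
  proof (rule antisym)
    show "(SUP T. ?I T * ?S T) \<le> (SUP T. ?I T) * (SUP T. ?S T)"
      by (intro SUP_least mult_mono SUP_upper) auto
    \<comment> \<open>Both factors increase, so the pair \<open>(i, j)\<close> is dominated by the
      diagonal index \<open>max i j\<close>.\<close>
    have "?I i * ?S j \<le> (SUP T. ?I T * ?S T)" for i j
    proof -
      have "?I i * ?S j \<le> ?I (max i j) * ?S (max i j)"
        by (intro mult_mono sum_mono2) (auto split: split_indicator simp: le_max_iff_disj)
      also have "\<dots> \<le> (SUP T. ?I T * ?S T)"
        by (rule SUP_upper) simp
      finally show ?thesis .
    qed
    then show "(SUP T. ?I T) * (SUP T. ?S T) \<le> (SUP T. ?I T * ?S T)"
      by (simp add: SUP_mult_right_ennreal SUP_mult_left_ennreal SUP_le_iff)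
  qed
  moreover have "(SUP T. ?I T) = indicator {\<omega>. \<exists>t. state_at M x \<omega> t = 0} \<omega>"
  proof (cases "\<exists>t. state_at M x \<omega> t = 0")
    case True
    then obtain t where "state_at M x \<omega> t = 0" ..
    then have "1 \<le> (SUP T. ?I T)"
      by (intro SUP_upper2[of t]) (auto simp: indicator_def)
    moreover have "(SUP T. ?I T) \<le> 1"
      by (intro SUP_least) (auto split: split_indicator)
    ultimately show ?thesis using True by simp
  qed simp
  ultimately show "indicator {\<omega>. \<exists>t. state_at M x \<omega> t = 0} \<omega> * (\<Sum>t. ennreal (cost_at M x \<omega> t))
      = (SUP T. ?I T * ?S T)"
    by (simp add: suminf_eq_SUP)
qed

text \<open>State 0 is absorbing and free of cost, but \<open>is_mdp\<close> says so only for
  actions in \<open>actions M\<close>; hence these must first be shown to occur almost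
  surely.\<close>

lemma J_obj_0:
  assumes "is_mdp M" "\<pi> \<in> policies M"
  shows "J_obj M 0 \<pi> = 0"
proof -
  have "AE \<omega> in path_measure M \<pi> 0. fst (\<omega> t) \<in> actions M" for t
  proof -
    define F :: "(nat \<Rightarrow> nat \<times> 'a) \<Rightarrow> ennreal" where "F \<omega> = indicator (- actions M) (fst (\<omega> t))" for \<omega>
    have pd: "prefix_determined (Suc t) F"
      by (auto simp: prefix_determined_def F_def)
    have "set_pmf (\<pi> t H) \<subseteq> actions M" for H
      using assms(2) by (simp only: policies_def mem_Collect_eq)
    then have "AE a in step_pmf M \<pi> 0 t \<omega>. F (fun_upd \<omega> t a) = 0" for \<omega>
      by (fastforce simp: AE_measure_pmf_iff step_pmf_def F_def)
    then have "(\<integral>\<^sup>+a. F (fun_upd \<omega> t a) \<partial>step_pmf M \<pi> 0 t \<omega>) = 0" for \<omega>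
      by (simp add: nn_integral_0_iff_AE)
    then have "(\<integral>\<^sup>+\<omega>. F \<omega> \<partial>path_measure M \<pi> 0) = 0"
      by (simp add: nn_integral_path_Suc[OF pd])
    then show ?thesis
      using borel_measurable_path[OF pd]
      by (simp add: nn_integral_0_iff_AE F_def indicator_eq_0_iff)
  qed
  then have "AE \<omega> in path_measure M \<pi> 0. \<forall>t. fst (\<omega> t) \<in> actions M"
    by (simp add: AE_all_countable)
  then have "AE \<omega> in path_measure M \<pi> 0. (\<Sum>t. ennreal (cost_at M 0 \<omega> t)) = 0"
  proof eventually_elim
    case (elim \<omega>)
    have "state_at M 0 \<omega> t = 0" for t
      using assms(1) elim by (induction t) (auto simp: is_mdp_def)
    then show ?case
      using assms(1) elim by (simp add: cost_at_def is_mdp_def)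
  qed
  then have "J_obj M 0 \<pi> = (\<integral>\<^sup>+\<omega>. 0 \<partial>path_measure M \<pi> 0)"
    unfolding J_obj_def by (intro nn_integral_cong_AE) (auto elim: eventually_mono)
  then show ?thesis by simp
qed

text \<open>Subsequences are extracted three times: for the policies, for \<open>J_obj\<close> in
  the compact order \<open>ennreal\<close>, and for \<open>L_d\<close> in the unit interval. The
  values of the limit policy only lie below \<open>j\<close> and \<open>l\<close>, which is all that
  minimization needs.\<close>

lemma policies_seq_compact:
  fixes M :: "('w::countable) mdp" and x :: nat
  assumes \<gamma>: "0 < \<gamma>" "\<gamma> < 1" and \<sigma>: "\<And>n. \<sigma> n \<in> policies M"
  obtains s :: "nat \<Rightarrow> nat" and \<pi> j l where "strict_mono s" "\<pi> \<in> policies M"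
    "(\<lambda>n. J_obj M x (\<sigma> (s n))) \<longlonglongrightarrow> j" "J_obj M x \<pi> \<le> j"
    "(\<lambda>n. L_d M \<gamma> x (\<sigma> (s n))) \<longlonglongrightarrow> l" "L_d M \<gamma> x \<pi> \<le> l"
proof -
  obtain s1 \<pi> where s1: "strict_mono (s1 :: nat \<Rightarrow> nat)" and \<pi>: "\<pi> \<in> policies M" and
    lim: "\<And>t \<omega> u. (\<lambda>n. pmf (\<sigma> (s1 n) t (history_at M x \<omega> t)) u) \<longlonglongrightarrow> pmf (\<pi> t (history_at M x \<omega> t)) u"
    using policies_subseq_limit[of \<sigma> M x] \<sigma> by blast
  obtain s2 j where s2: "strict_mono (s2 :: nat \<Rightarrow> nat)"
    and j: "((\<lambda>n. J_obj M x (\<sigma> (s1 n))) \<circ> s2) \<longlonglongrightarrow> j"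
    using compact_complete_linorder by blast
  have "bounded (range (\<lambda>n. L_d M \<gamma> x (\<sigma> (s1 (s2 n)))))"
    by (auto simp: bounded_iff abs_of_nonneg L_d_nonneg[OF \<gamma>] L_d_le_1[OF \<gamma>] intro!: exI[of _ 1])
  from bounded_imp_convergent_subsequence[OF this] obtain s3 l where s3: "strict_mono (s3 :: nat \<Rightarrow> nat)"
    and l: "((\<lambda>n. L_d M \<gamma> x (\<sigma> (s1 (s2 n)))) \<circ> s3) \<longlonglongrightarrow> l"
    by blast
  define s where "s = s1 \<circ> s2 \<circ> s3"
  have s: "strict_mono s"
    unfolding s_def by (intro strict_mono_o s1 s2 s3)
  have j: "(\<lambda>n. J_obj M x (\<sigma> (s n))) \<longlonglongrightarrow> j"
    using LIMSEQ_subseq_LIMSEQ[OF j s3] by (simp add: s_def o_def)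
  have l: "(\<lambda>n. L_d M \<gamma> x (\<sigma> (s n))) \<longlonglongrightarrow> l"
    using l by (simp add: s_def o_def)
  have lim: "(\<lambda>n. pmf (\<sigma> (s n) t (history_at M x \<omega> t)) u) \<longlonglongrightarrow> pmf (\<pi> t (history_at M x \<omega> t)) u"
    for t \<omega> u
    using LIMSEQ_subseq_LIMSEQ[OF lim[of t \<omega> u] strict_mono_o[OF s2 s3]] by (simp add: s_def o_def)
  have "J_obj M x \<pi> \<le> liminf (\<lambda>n. J_obj M x (\<sigma> (s n)))"
    unfolding J_obj_SUP
  proof (rule nn_integral_path_lsc[where \<sigma> = "\<lambda>n. \<sigma> (s n)" and \<pi> = \<pi>, OF lim])
    fix T
    show "prefix_determined T (\<lambda>\<omega>. indicator {\<omega>. \<exists>t\<le>T. state_at M x \<omega> t = 0} \<omega>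
        * (\<Sum>t<T. ennreal (cost_at M x \<omega> t)))"
    proof (rule prefix_determined_compose2[where f = "(*)"])
      show "prefix_determined T (indicator {\<omega>. \<exists>t\<le>T. state_at M x \<omega> t = 0} :: _ \<Rightarrow> ennreal)"
        unfolding prefix_determined_def
      proof (intro allI impI)
        fix \<omega> \<omega>' :: "nat \<Rightarrow> nat \<times> 'w"
        assume "\<forall>k<T. \<omega> k = \<omega>' k"
        then have "state_at M x \<omega> t = state_at M x \<omega>' t" if "t \<le> T" for t
          using that by (intro state_at_cong) simp
        then have "(\<exists>t\<le>T. state_at M x \<omega> t = 0) = (\<exists>t\<le>T. state_at M x \<omega>' t = 0)"
          by metis
        then show "(indicator {\<omega>. \<exists>t\<le>T. state_at M x \<omega> t = 0} \<omega> :: ennreal)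
            = indicator {\<omega>. \<exists>t\<le>T. state_at M x \<omega> t = 0} \<omega>'"
          by (simp only: indicator_def mem_Collect_eq)
      qed
      show "prefix_determined T (\<lambda>\<omega>. \<Sum>t<T. ennreal (cost_at M x \<omega> t))"
        by (intro prefix_determined_sum prefix_determined_compose[of _ _ ennreal] prefix_determined_cost_at) auto
    qed
  next
    show "incseq (\<lambda>T \<omega>. indicator {\<omega>. \<exists>t\<le>T. state_at M x \<omega> t = 0} \<omega>
        * (\<Sum>t<T. ennreal (cost_at M x \<omega> t)))"
      by (auto simp: incseq_def le_fun_def split: split_indicator intro!: mult_mono sum_mono2)
  qed
  with j have J: "J_obj M x \<pi> \<le> j"
    by (simp add: lim_imp_Liminf)
  have "ennreal (L_d M \<gamma> x \<pi>) \<le> liminf (\<lambda>n. ennreal (L_d M \<gamma> x (\<sigma> (s n))))"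
    unfolding ennreal_L_d[OF \<gamma>]
  proof (rule nn_integral_path_lsc[where \<sigma> = "\<lambda>n. \<sigma> (s n)" and \<pi> = \<pi>, OF lim])
    fix T
    show "prefix_determined T (\<lambda>\<omega>. \<Sum>t<T. ennreal (\<gamma> ^ t * (1 - \<gamma>) * h_d (state_at M x \<omega> t)))"
      by (intro prefix_determined_sum
            prefix_determined_compose[of _ _ "\<lambda>y. ennreal (_ * h_d y)"] prefix_determined_state_at) auto
  next
    show "incseq (\<lambda>T \<omega>. \<Sum>t<T. ennreal (\<gamma> ^ t * (1 - \<gamma>) * h_d (state_at M x \<omega> t)))"
      by (auto simp: incseq_def le_fun_def intro!: sum_mono2)
  qed
  moreover have "liminf (\<lambda>n. ennreal (L_d M \<gamma> x (\<sigma> (s n)))) = ennreal l"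
    by (intro lim_imp_Liminf tendsto_ennrealI l) simp
  moreover have "0 \<le> l"
    using L_d_nonneg[OF \<gamma>] by (intro LIMSEQ_le_const[OF l]) auto
  ultimately have "L_d M \<gamma> x \<pi> \<le> l"
    by simp
  with s \<pi> j J l show thesis by (rule that)
qed

section \<open>Existence of minimizers\<close>

text \<open>The direct method for a general criterion \<open>\<Phi>\<close>, later the maximum
  \<open>J_max\<close>, the ratio \<open>J_S3P\<close> or a multiple of \<open>J_obj\<close>.
  Continuity handles a minimizing sequence; monotonicity passes from the limits \<open>j\<close>,
  \<open>l\<close> to the smaller values at \<open>\<pi>\<close>. The bound \<open>l \<le> e\<close>
  keeps \<open>1 / (1 - l)\<close> admissible as a factor when \<open>e < 1\<close>.\<close>

lemma feasible_minimizer_exists: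
  fixes M :: "('w::countable) mdp" and \<Phi> :: "ennreal \<Rightarrow> real \<Rightarrow> ennreal"
  assumes \<gamma>: "0 < \<gamma>" "\<gamma> < 1" and ne: "feasible M \<gamma> x e \<noteq> {}"
    and cont: "\<And>j l jn ln. jn \<longlonglongrightarrow> j \<Longrightarrow> ln \<longlonglongrightarrow> l \<Longrightarrow> 0 \<le> l \<Longrightarrow> l \<le> e \<Longrightarrow>
      (\<lambda>n::nat. \<Phi> (jn n) (ln n)) \<longlonglongrightarrow> \<Phi> j l"
    and mono: "\<And>j j' l l'. j \<le> j' \<Longrightarrow> 0 \<le> l \<Longrightarrow> l \<le> l' \<Longrightarrow> l' \<le> e \<Longrightarrow> \<Phi> j l \<le> \<Phi> j' l'"
  obtains \<pi> where "\<pi> \<in> feasible M \<gamma> x e"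
    "\<And>\<pi>'. \<pi>' \<in> feasible M \<gamma> x e \<Longrightarrow>
      \<Phi> (J_obj M x \<pi>) (L_d M \<gamma> x \<pi>) \<le> \<Phi> (J_obj M x \<pi>') (L_d M \<gamma> x \<pi>')"
proof -
  let ?f = "\<lambda>\<pi>. \<Phi> (J_obj M x \<pi>) (L_d M \<gamma> x \<pi>)"
  let ?I = "INF \<pi>\<in>feasible M \<gamma> x e. ?f \<pi>"
  obtain v where v: "\<And>n. v n \<in> ?f ` feasible M \<gamma> x e" "v \<longlonglongrightarrow> ?I"
    using Inf_as_limit[of "?f ` feasible M \<gamma> x e"] ne by blast
  then obtain \<sigma> where \<sigma>: "\<And>n. \<sigma> n \<in> feasible M \<gamma> x e" "\<And>n. v n = ?f (\<sigma> n)"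
    unfolding image_iff Bex_def by metis
  obtain s \<pi> j l where s: "strict_mono (s :: nat \<Rightarrow> nat)" and \<pi>: "\<pi> \<in> policies M"
    and J: "(\<lambda>n. J_obj M x (\<sigma> (s n))) \<longlonglongrightarrow> j" "J_obj M x \<pi> \<le> j"
    and L: "(\<lambda>n. L_d M \<gamma> x (\<sigma> (s n))) \<longlonglongrightarrow> l" "L_d M \<gamma> x \<pi> \<le> l"
    using policies_seq_compact[OF \<gamma>, of \<sigma> M x] \<sigma>(1) unfolding feasible_def by blast
  have "l \<le> e"
    using \<sigma>(1) by (intro LIMSEQ_le_const2[OF L(1)]) (auto simp: feasible_def)
  moreover have "0 \<le> l"
    using L(2) L_d_nonneg[OF \<gamma>, of M x \<pi>] by linarith
  ultimately have "(\<lambda>n. v (s n)) \<longlonglongrightarrow> \<Phi> j l"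
    unfolding \<sigma>(2) by (intro cont J L)
  moreover have "(\<lambda>n. v (s n)) \<longlonglongrightarrow> ?I"
    using LIMSEQ_subseq_LIMSEQ[OF v(2) s] by (simp add: o_def)
  ultimately have "\<Phi> j l = ?I"
    by (rule LIMSEQ_unique)
  moreover have "?f \<pi> \<le> \<Phi> j l"
    using J(2) L(2) \<open>l \<le> e\<close> L_d_nonneg[OF \<gamma>] by (intro mono) auto
  ultimately have "?f \<pi> \<le> ?I"
    by simp
  moreover have "\<pi> \<in> feasible M \<gamma> x e"
    using \<pi> L(2) \<open>l \<le> e\<close> by (simp add: feasible_def)
  ultimately show thesis
    by (intro that) (auto simp: le_INF_iff)
qed

section \<open>The parametrized minimax problem\<close>

context
  fixes M :: "('w::countable) mdp" and \<gamma> :: real and x :: nat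
  assumes \<gamma>: "0 < \<gamma>" "\<gamma> < 1"
begin

text \<open>Lets the unconstrained minimax problem be treated as a constrained one.\<close>

lemma feasible_1: "feasible M \<gamma> x 1 = policies M"
  using L_d_le_1[OF \<gamma>] by (auto simp: feasible_def)

text \<open>Each mixture is a convex combination of the two values, and the weights
  \<open>(1, 0)\<close> and \<open>(0, 1)\<close> recover them.\<close>

lemma J_max_eq_max:
  assumes "0 \<le> c" "0 < \<epsilon>'" "\<epsilon>' < 1"
  shows "J_max M c \<gamma> \<epsilon>' x \<pi> = max (J_obj M x \<pi>) (ennreal (c * (1 - \<epsilon>') / \<epsilon>' * L_d M \<gamma> x \<pi>))"
    (is "_ = max ?J (ennreal ?K)")
proof (rule antisym)
  have K: "0 \<le> ?K"
    using assms L_d_nonneg[OF \<gamma>, of M x \<pi>] by simp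
  show "J_max M c \<gamma> \<epsilon>' x \<pi> \<le> max ?J (ennreal ?K)"
    unfolding J_max_def
  proof (rule SUP_least)
    fix \<alpha> :: "real \<times> real"
    assume \<alpha>: "\<alpha> \<in> weights"
    then have pos: "0 \<le> fst \<alpha>" "0 \<le> snd \<alpha>" and one: "fst \<alpha> + snd \<alpha> = 1"
      by (auto simp: weights_def)
    have "J_mix M c \<gamma> \<epsilon>' x \<alpha> \<pi> = ennreal (fst \<alpha>) * ?J + ennreal (snd \<alpha>) * ennreal ?K"
      unfolding J_mix_def using pos K by (simp add: ennreal_mult'[symmetric] mult_ac)
    also have "\<dots> \<le> ennreal (fst \<alpha>) * max ?J (ennreal ?K) + ennreal (snd \<alpha>) * max ?J (ennreal ?K)"
      by (intro add_mono mult_left_mono) auto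
    also have "\<dots> = (ennreal (fst \<alpha>) + ennreal (snd \<alpha>)) * max ?J (ennreal ?K)"
      by (simp add: distrib_right)
    also have "\<dots> = max ?J (ennreal ?K)"
      using pos one by (simp flip: ennreal_plus)
    finally show "J_mix M c \<gamma> \<epsilon>' x \<alpha> \<pi> \<le> max ?J (ennreal ?K)" .
  qed
  have "J_mix M c \<gamma> \<epsilon>' x (1, 0) \<pi> \<le> J_max M c \<gamma> \<epsilon>' x \<pi>" "J_mix M c \<gamma> \<epsilon>' x (0, 1) \<pi> \<le> J_max M c \<gamma> \<epsilon>' x \<pi>"
    unfolding J_max_def by (intro SUP_upper; simp add: weights_def)+
  then show "max ?J (ennreal ?K) \<le> J_max M c \<gamma> \<epsilon>' x \<pi>"
    by (simp add: J_mix_def)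
qed

lemma J_max_minimizer_exists:
  assumes c: "0 \<le> c" and \<epsilon>': "0 < \<epsilon>'" "\<epsilon>' < 1" and ne: "policies M \<noteq> {}"
  obtains \<pi> where "is_arg_min (J_max M c \<gamma> \<epsilon>' x) (\<lambda>\<pi>. \<pi> \<in> policies M) \<pi>"
proof -
  let ?\<Phi> = "\<lambda>j l. max j (ennreal (c * (1 - \<epsilon>') / \<epsilon>' * l))"
  obtain \<pi> where "\<pi> \<in> feasible M \<gamma> x 1"
    "\<And>\<pi>'. \<pi>' \<in> feasible M \<gamma> x 1 \<Longrightarrow>
      ?\<Phi> (J_obj M x \<pi>) (L_d M \<gamma> x \<pi>) \<le> ?\<Phi> (J_obj M x \<pi>') (L_d M \<gamma> x \<pi>')"
  proof (rule feasible_minimizer_exists[OF \<gamma>, of M x 1 ?\<Phi>])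
    show "feasible M \<gamma> x 1 \<noteq> {}"
      using ne by (simp add: feasible_1)
    show "(\<lambda>n. ?\<Phi> (jn n) (ln n)) \<longlonglongrightarrow> ?\<Phi> j l" if "jn \<longlonglongrightarrow> j" "ln \<longlonglongrightarrow> l" for jn ln j l
      using that by (intro tendsto_max tendsto_ennrealI tendsto_mult tendsto_const)
    show "?\<Phi> j l \<le> ?\<Phi> j' l'" if "j \<le> j'" "l \<le> l'" for j j' l l'
      using that c \<epsilon>' by (intro max.mono ennreal_leI mult_left_mono) auto
  qed blast
  then show thesis
    using that[of \<pi>] unfolding is_arg_min_linorder feasible_1 J_max_eq_max[OF c \<epsilon>'] by blast
qed

section \<open>The closed form of \<open>cstar\<close>\<close>

lemma ennreal_scale_le_iff:
  assumes "0 \<le> c" "0 < a"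
  shows "ennreal (1 / a) * j \<le> ennreal c \<longleftrightarrow> j \<le> ennreal (c * a)"
proof
  assume "ennreal (1 / a) * j \<le> ennreal c"
  then have "ennreal a * (ennreal (1 / a) * j) \<le> ennreal a * ennreal c"
    by (rule mult_left_mono) simp
  moreover have "ennreal a * (ennreal (1 / a) * j) = j"
    using assms by (simp add: mult.assoc[symmetric] ennreal_mult'[symmetric])
  moreover have "ennreal a * ennreal c = ennreal (c * a)"
    using assms by (simp add: ennreal_mult'[symmetric] mult.commute)
  ultimately show "j \<le> ennreal (c * a)"
    by simp
next
  assume "j \<le> ennreal (c * a)"
  then have "ennreal (1 / a) * j \<le> ennreal (1 / a) * ennreal (c * a)"
    by (rule mult_left_mono) simp
  also have "\<dots> = ennreal c"
    using assms by (simp add: ennreal_mult'[symmetric])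
  finally show "ennreal (1 / a) * j \<le> ennreal c" .
qed

text \<open>Cancelling \<open>c * (1 - \<epsilon>')\<close> turns the bound on the weighted term
  back into the constraint. At \<open>c = 0\<close> the bound would say nothing about
  \<open>l\<close>.\<close>

lemma le_if_scaled_le:
  fixes c \<epsilon>' l :: real
  assumes "0 < c" "0 < \<epsilon>'" "\<epsilon>' < 1" "c * (1 - \<epsilon>') / \<epsilon>' * l \<le> c * (1 - \<epsilon>')"
  shows "l \<le> \<epsilon>'"
proof -
  have "c * (1 - \<epsilon>') * (l / \<epsilon>') \<le> c * (1 - \<epsilon>') * 1"
    using assms(4) by simp
  then have "l / \<epsilon>' \<le> 1"
    by (rule mult_left_le_imp_le) (use assms in simp)
  then show ?thesis
    using assms(2) by (simp add: divide_le_eq)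
qed

lemma cstar_eq:
  assumes \<epsilon>': "0 < \<epsilon>'" "\<epsilon>' < 1"
  shows "cstar M \<gamma> x \<epsilon>' = (INF \<pi>\<in>feasible M \<gamma> x \<epsilon>'. ennreal (1 / (1 - \<epsilon>')) * J_obj M x \<pi>)"
proof (rule antisym)
  show "cstar M \<gamma> x \<epsilon>' \<le> (INF \<pi>\<in>feasible M \<gamma> x \<epsilon>'. ennreal (1 / (1 - \<epsilon>')) * J_obj M x \<pi>)"
  proof (rule INF_greatest)
    fix \<pi>
    assume \<pi>: "\<pi> \<in> feasible M \<gamma> x \<epsilon>'"
    show "cstar M \<gamma> x \<epsilon>' \<le> ennreal (1 / (1 - \<epsilon>')) * J_obj M x \<pi>"
    \<comment> \<open>The value to be bounded may be 0 or infinite, neither of which is an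
      admissible multiplier; every finite \<open>y\<close> strictly above it is one.\<close>
    proof (rule dense_ge)
      fix y
      assume y: "ennreal (1 / (1 - \<epsilon>')) * J_obj M x \<pi> < y"
      show "cstar M \<gamma> x \<epsilon>' \<le> y"
      proof (cases y)
        case (real c)
        have c: "0 < c"
          using y real by (metis ennreal_0 le_less not_less_zero)
        have "J_obj M x \<pi> \<le> ennreal (c * (1 - \<epsilon>'))"
          using y real c \<epsilon>' by (simp add: ennreal_scale_le_iff[symmetric])
        moreover have "c * (1 - \<epsilon>') / \<epsilon>' * L_d M \<gamma> x \<pi> \<le> c * (1 - \<epsilon>') / \<epsilon>' * \<epsilon>'"
          using \<pi> c \<epsilon>' by (intro mult_left_mono) (auto simp: feasible_def)
        ultimately have "J_max M c \<gamma> \<epsilon>' x \<pi> \<le> ennreal (c * (1 - \<epsilon>'))"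
          using c \<epsilon>' by (simp add: J_max_eq_max ennreal_leI)
        then have "(INF \<pi>\<in>policies M. J_max M c \<gamma> \<epsilon>' x \<pi>) \<le> ennreal (c * (1 - \<epsilon>'))"
          using \<pi> by (intro INF_lower2[of \<pi>]) (auto simp: feasible_def)
        then show ?thesis
          unfolding cstar_def real using c by (intro INF_lower) auto
      qed simp
    qed
  qed
  show "(INF \<pi>\<in>feasible M \<gamma> x \<epsilon>'. ennreal (1 / (1 - \<epsilon>')) * J_obj M x \<pi>) \<le> cstar M \<gamma> x \<epsilon>'"
    unfolding cstar_def
  proof (rule INF_greatest)
    fix c
    assume "c \<in> {c. 0 < c \<and> (INF \<pi>\<in>policies M. J_max M c \<gamma> \<epsilon>' x \<pi>) \<le> ennreal (c * (1 - \<epsilon>'))}"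
    then have c: "0 < c" and le: "(INF \<pi>\<in>policies M. J_max M c \<gamma> \<epsilon>' x \<pi>) \<le> ennreal (c * (1 - \<epsilon>'))"
      by auto
    have "policies M \<noteq> {}"
      using le by (auto simp: top_unique)
    \<comment> \<open>Attainment matters here: the bound on the infimum alone would give policies
      that meet the constraint only approximately.\<close>
    then obtain \<pi> where "is_arg_min (J_max M c \<gamma> \<epsilon>' x) (\<lambda>\<pi>. \<pi> \<in> policies M) \<pi>"
      using J_max_minimizer_exists[OF less_imp_le[OF c] \<epsilon>'] by blast
    then have \<pi>: "\<pi> \<in> policies M"
      "\<And>\<pi>'. \<pi>' \<in> policies M \<Longrightarrow> J_max M c \<gamma> \<epsilon>' x \<pi> \<le> J_max M c \<gamma> \<epsilon>' x \<pi>'"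
      unfolding is_arg_min_linorder by auto
    have "J_max M c \<gamma> \<epsilon>' x \<pi> \<le> (INF \<pi>\<in>policies M. J_max M c \<gamma> \<epsilon>' x \<pi>)"
      by (rule INF_greatest) (rule \<pi>(2))
    then have "J_max M c \<gamma> \<epsilon>' x \<pi> \<le> ennreal (c * (1 - \<epsilon>'))"
      using le by (rule order_trans)
    then have J: "J_obj M x \<pi> \<le> ennreal (c * (1 - \<epsilon>'))"
      and "ennreal (c * (1 - \<epsilon>') / \<epsilon>' * L_d M \<gamma> x \<pi>) \<le> ennreal (c * (1 - \<epsilon>'))"
      using c \<epsilon>' by (simp_all add: J_max_eq_max)
    then have "c * (1 - \<epsilon>') / \<epsilon>' * L_d M \<gamma> x \<pi> \<le> c * (1 - \<epsilon>')"
      using c \<epsilon>' by simp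
    then have "L_d M \<gamma> x \<pi> \<le> \<epsilon>'"
      by (intro le_if_scaled_le[OF c \<epsilon>'])
    with \<pi> have "\<pi> \<in> feasible M \<gamma> x \<epsilon>'"
      by (simp add: feasible_def)
    then have "(INF \<pi>\<in>feasible M \<gamma> x \<epsilon>'. ennreal (1 / (1 - \<epsilon>')) * J_obj M x \<pi>)
        \<le> ennreal (1 / (1 - \<epsilon>')) * J_obj M x \<pi>"
      by (rule INF_lower)
    also have "\<dots> \<le> ennreal c"
      using J c \<epsilon>' by (simp add: ennreal_scale_le_iff)
    finally show "(INF \<pi>\<in>feasible M \<gamma> x \<epsilon>'. ennreal (1 / (1 - \<epsilon>')) * J_obj M x \<pi>) \<le> ennreal c" .
  qed
qed

lemma J_S3P_minimizer_exists:
  assumes "\<epsilon> < 1" and ne: "feasible M \<gamma> x \<epsilon> \<noteq> {}"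
  obtains \<pi> where "is_arg_min (J_S3P M \<gamma> x) (\<lambda>\<pi>. \<pi> \<in> feasible M \<gamma> x \<epsilon>) \<pi>"
proof -
  let ?\<Phi> = "\<lambda>j l. ennreal (1 / (1 - l)) * j"
  obtain \<pi> where "\<pi> \<in> feasible M \<gamma> x \<epsilon>"
    "\<And>\<pi>'. \<pi>' \<in> feasible M \<gamma> x \<epsilon> \<Longrightarrow>
      ?\<Phi> (J_obj M x \<pi>) (L_d M \<gamma> x \<pi>) \<le> ?\<Phi> (J_obj M x \<pi>') (L_d M \<gamma> x \<pi>')"
  proof (rule feasible_minimizer_exists[OF \<gamma> ne, of ?\<Phi>])
    \<comment> \<open>As \<open>l \<le> \<epsilon> < 1\<close>, the factor has a positive finite
      limit, so multiplication is continuous even at \<open>j = \<infinity>\<close>.\<close>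
    show "(\<lambda>n. ?\<Phi> (jn n) (ln n)) \<longlonglongrightarrow> ?\<Phi> j l" if "jn \<longlonglongrightarrow> j" "ln \<longlonglongrightarrow> l" "l \<le> \<epsilon>" for jn ln j l
      using that assms(1)
      by (intro tendsto_mult_ennreal tendsto_ennrealI tendsto_divide tendsto_diff tendsto_const)
         (auto simp: ennreal_eq_0_iff)
    show "?\<Phi> j l \<le> ?\<Phi> j' l'" if "j \<le> j'" "l \<le> l'" "l' \<le> \<epsilon>" for j j' l l'
      using that assms(1) by (intro mult_mono ennreal_leI divide_left_mono) auto
  qed blast
  then show thesis
    using that[of \<pi>] unfolding is_arg_min_linorder J_S3P_def by blast
qed

section \<open>Comparison of the optimal \<open>J_S3P\<close> with \<open>cstar\<close>\<close>

lemma feasible_mono: "e \<le> e' \<Longrightarrow> feasible M \<gamma> x e \<subseteq> feasible M \<gamma> x e'"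
  by (auto simp: feasible_def)

text \<open>Lowering \<open>\<epsilon>'\<close> shrinks the feasible set, and on it the factor
  \<open>1 / (1 - L_d)\<close> is at most \<open>1 / (1 - \<epsilon>')\<close>.\<close>

lemma INF_J_S3P_le_cstar:
  assumes "0 < \<epsilon>'" "\<epsilon>' \<le> \<epsilon>" "\<epsilon> < 1"
  shows "(INF \<pi>\<in>feasible M \<gamma> x \<epsilon>. J_S3P M \<gamma> x \<pi>) \<le> cstar M \<gamma> x \<epsilon>'"
proof -
  have "(INF \<pi>\<in>feasible M \<gamma> x \<epsilon>. J_S3P M \<gamma> x \<pi>) \<le> (INF \<pi>\<in>feasible M \<gamma> x \<epsilon>'. J_S3P M \<gamma> x \<pi>)"
    using assms by (intro INF_superset_mono feasible_mono) auto
  also have "\<dots> \<le> (INF \<pi>\<in>feasible M \<gamma> x \<epsilon>'. ennreal (1 / (1 - \<epsilon>')) * J_obj M x \<pi>)"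
    unfolding J_S3P_def using assms
    by (intro INF_mono' mult_right_mono ennreal_leI divide_left_mono INF_superset_mono)
       (auto simp: feasible_def)
  finally show ?thesis
    using assms by (simp add: cstar_eq)
qed

text \<open>The optimal \<open>\<epsilon>'\<close> is the value \<open>L\<^sub>d\<close> of an optimal policy. It is positive unless \<open>x = 0\<close>,
  where every policy has cost 0.\<close>

lemma cstar_le_INF_J_S3P:
  assumes "is_mdp M" "0 < \<epsilon>" "\<epsilon> < 1"
  obtains \<epsilon>' where "0 < \<epsilon>'" "\<epsilon>' \<le> \<epsilon>" "cstar M \<gamma> x \<epsilon>' \<le> (INF \<pi>\<in>feasible M \<gamma> x \<epsilon>. J_S3P M \<gamma> x \<pi>)"
proof (cases "feasible M \<gamma> x \<epsilon> = {}")
  case True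
  then show thesis
    using assms by (intro that[of \<epsilon>]) auto
next
  case False
  then obtain \<pi> where "is_arg_min (J_S3P M \<gamma> x) (\<lambda>\<pi>. \<pi> \<in> feasible M \<gamma> x \<epsilon>) \<pi>"
    using J_S3P_minimizer_exists[OF \<open>\<epsilon> < 1\<close>] by blast
  then have \<pi>: "\<pi> \<in> feasible M \<gamma> x \<epsilon>"
    and min: "J_S3P M \<gamma> x \<pi> \<le> (INF \<pi>\<in>feasible M \<gamma> x \<epsilon>. J_S3P M \<gamma> x \<pi>)"
    by (auto simp: is_arg_min_linorder le_INF_iff)
  show thesis
  proof (cases "x = 0")
    \<comment> \<open>Here \<open>L_d\<close> may be 0 and hence outside the range of
      \<open>\<epsilon>'\<close>; as the cost vanishes, \<open>\<epsilon>\<close> itself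
      serves.\<close>
    case True
    then have "J_obj M x \<pi> = 0"
      using J_obj_0[OF assms(1)] \<pi> by (simp add: feasible_def)
    then have "cstar M \<gamma> x \<epsilon> \<le> 0"
      unfolding cstar_eq[OF assms(2,3)] by (intro INF_lower2[OF \<pi>]) simp
    then show thesis
      using assms by (intro that[of \<epsilon>]) auto
  next
    case False
    then have pos: "0 < L_d M \<gamma> x \<pi>"
      by (rule L_d_pos[OF \<gamma>])
    \<comment> \<open>The policy is feasible for its own \<open>L_d\<close>, where the factor
      \<open>1 / (1 - \<epsilon>')\<close> is exactly that of \<open>J_S3P\<close>.\<close>
    have le: "L_d M \<gamma> x \<pi> \<le> \<epsilon>" and "\<pi> \<in> feasible M \<gamma> x (L_d M \<gamma> x \<pi>)"
      using \<pi> by (auto simp: feasible_def)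
    then have "cstar M \<gamma> x (L_d M \<gamma> x \<pi>) \<le> J_S3P M \<gamma> x \<pi>"
      using pos assms by (subst cstar_eq) (auto simp: J_S3P_def intro: INF_lower)
    then show thesis
      using min by (intro that[OF pos le]) (rule order_trans)
  qed
qed

text \<open>A policy attaining the closed form of \<open>cstar\<close> keeps \<open>J_max\<close>
  within \<open>c * (1 - \<epsilon>')\<close>, so the minimax policy does as well. This bounds its
  cost from above; for \<open>c > 0\<close> it also makes the policy feasible, and the closed form
  then bounds the cost from below.\<close>

lemma J_obj_of_J_max_minimizer:
  assumes \<epsilon>': "0 < \<epsilon>'" "\<epsilon>' < 1" and c: "0 \<le> c" "cstar M \<gamma> x \<epsilon>' = ennreal c"
    and \<pi>: "is_arg_min (J_max M c \<gamma> \<epsilon>' x) (\<lambda>\<pi>. \<pi> \<in> policies M) \<pi>"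
  shows "ennreal (1 / (1 - \<epsilon>')) * J_obj M x \<pi> = ennreal c"
proof (rule antisym)
  have ne: "feasible M \<gamma> x \<epsilon>' \<noteq> {}"
    using c by (auto simp: cstar_eq[OF \<epsilon>'])
  obtain \<rho> where \<rho>: "\<rho> \<in> feasible M \<gamma> x \<epsilon>'"
    "\<And>\<rho>'. \<rho>' \<in> feasible M \<gamma> x \<epsilon>' \<Longrightarrow>
      ennreal (1 / (1 - \<epsilon>')) * J_obj M x \<rho> \<le> ennreal (1 / (1 - \<epsilon>')) * J_obj M x \<rho>'"
    by (rule feasible_minimizer_exists[OF \<gamma> ne, of "\<lambda>j l. ennreal (1 / (1 - \<epsilon>')) * j"])
       (auto intro: ennreal_tendsto_cmult mult_left_mono)
  then have "ennreal (1 / (1 - \<epsilon>')) * J_obj M x \<rho> \<le> ennreal c"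
    unfolding c(2)[symmetric] cstar_eq[OF \<epsilon>'] by (intro INF_greatest)
  then have "J_obj M x \<rho> \<le> ennreal (c * (1 - \<epsilon>'))"
    using c \<epsilon>' by (simp add: ennreal_scale_le_iff[symmetric])
  moreover have "c * (1 - \<epsilon>') / \<epsilon>' * L_d M \<gamma> x \<rho> \<le> c * (1 - \<epsilon>') / \<epsilon>' * \<epsilon>'"
    using \<rho>(1) c \<epsilon>' by (intro mult_left_mono) (auto simp: feasible_def)
  ultimately have "J_max M c \<gamma> \<epsilon>' x \<rho> \<le> ennreal (c * (1 - \<epsilon>'))"
    using c \<epsilon>' by (simp add: J_max_eq_max ennreal_leI)
  moreover have "J_max M c \<gamma> \<epsilon>' x \<pi> \<le> J_max M c \<gamma> \<epsilon>' x \<rho>"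
    using \<pi> \<rho>(1) by (auto simp: is_arg_min_linorder feasible_def)
  ultimately have "J_max M c \<gamma> \<epsilon>' x \<pi> \<le> ennreal (c * (1 - \<epsilon>'))"
    by simp
  then have J: "J_obj M x \<pi> \<le> ennreal (c * (1 - \<epsilon>'))"
    and L: "ennreal (c * (1 - \<epsilon>') / \<epsilon>' * L_d M \<gamma> x \<pi>) \<le> ennreal (c * (1 - \<epsilon>'))"
    using c \<epsilon>' by (simp_all add: J_max_eq_max)
  show "ennreal (1 / (1 - \<epsilon>')) * J_obj M x \<pi> \<le> ennreal c"
    using J c \<epsilon>' by (simp add: ennreal_scale_le_iff)
  show "ennreal c \<le> ennreal (1 / (1 - \<epsilon>')) * J_obj M x \<pi>"
  \<comment> \<open>For \<open>c = 0\<close> the policy may be infeasible, as \<open>J_max\<close>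
    no longer sees \<open>L_d\<close>, but the lower bound is then just 0.\<close>
  proof (cases "c = 0")
    case False
    with c have "0 < c" by simp
    have "c * (1 - \<epsilon>') / \<epsilon>' * L_d M \<gamma> x \<pi> \<le> c * (1 - \<epsilon>')"
      using c(1) \<epsilon>' L by simp
    with \<open>0 < c\<close> \<epsilon>' have "L_d M \<gamma> x \<pi> \<le> \<epsilon>'"
      by (rule le_if_scaled_le)
    then have "\<pi> \<in> feasible M \<gamma> x \<epsilon>'"
      using \<pi> by (simp add: feasible_def is_arg_min_linorder)
    then show ?thesis
      unfolding c(2)[symmetric] cstar_eq[OF \<epsilon>'] by (rule INF_lower)
  qed simp
qed

end

text \<open>The equality of minima is stated for infima, with attainment as separate claims; if no
  policy is feasible, both infima are infinite. The last claim covers every minimax policy and also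
  asserts that one exists.\<close>

theorem theorem5:
  fixes M :: "('w::countable) mdp" and \<gamma> \<epsilon> :: real and x :: nat
  assumes "is_mdp M"
    and "0 < \<gamma>" and "\<gamma> < 1"
    and "0 < \<epsilon>" and "\<epsilon> < 1"
    and "x \<in> states M"
  shows "(INF \<pi>\<in>feasible M \<gamma> x \<epsilon>. J_S3P M \<gamma> x \<pi>) = (INF \<epsilon>'\<in>{0<..\<epsilon>}. cstar M \<gamma> x \<epsilon>')
    \<and> (feasible M \<gamma> x \<epsilon> \<noteq> {} \<longrightarrow>
         (\<exists>\<pi>. is_arg_min (J_S3P M \<gamma> x) (\<lambda>\<pi>. \<pi> \<in> feasible M \<gamma> x \<epsilon>) \<pi>))
    \<and> (\<exists>\<epsilon>'. is_arg_min (cstar M \<gamma> x) (\<lambda>\<epsilon>'. \<epsilon>' \<in> {0<..\<epsilon>}) \<epsilon>')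
    \<and> (\<forall>\<epsilon>s. is_arg_min (cstar M \<gamma> x) (\<lambda>\<epsilon>'. \<epsilon>' \<in> {0<..\<epsilon>}) \<epsilon>s \<and> cstar M \<gamma> x \<epsilon>s \<noteq> \<infinity> \<longrightarrow>
         (\<exists>\<pi>s. is_arg_min (J_max M (enn2real (cstar M \<gamma> x \<epsilon>s)) \<gamma> \<epsilon>s x)
                 (\<lambda>\<pi>. \<pi> \<in> policies M) \<pi>s)
       \<and> (\<forall>\<pi>s. is_arg_min (J_max M (enn2real (cstar M \<gamma> x \<epsilon>s)) \<gamma> \<epsilon>s x)
                 (\<lambda>\<pi>. \<pi> \<in> policies M) \<pi>s \<longrightarrow>
            (INF \<pi>\<in>feasible M \<gamma> x \<epsilon>. J_S3P M \<gamma> x \<pi>) = ennreal (1 / (1 - \<epsilon>s)) * J_obj M x \<pi>s))"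
proof (intro conjI impI allI)
  note \<gamma> = assms(2,3)
  let ?A = "INF \<pi>\<in>feasible M \<gamma> x \<epsilon>. J_S3P M \<gamma> x \<pi>"
  obtain \<epsilon>0 where \<epsilon>0: "0 < \<epsilon>0" "\<epsilon>0 \<le> \<epsilon>" "cstar M \<gamma> x \<epsilon>0 \<le> ?A"
    by (rule cstar_le_INF_J_S3P[OF \<gamma> assms(1,4,5)])
  have le: "?A \<le> cstar M \<gamma> x \<epsilon>'" if "\<epsilon>' \<in> {0<..\<epsilon>}" for \<epsilon>'
    by (rule INF_J_S3P_le_cstar[OF \<gamma>]) (use that assms(5) in auto)
  show eq: "?A = (INF \<epsilon>'\<in>{0<..\<epsilon>}. cstar M \<gamma> x \<epsilon>')"
  proof (rule antisym)
    show "?A \<le> (INF \<epsilon>'\<in>{0<..\<epsilon>}. cstar M \<gamma> x \<epsilon>')"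
      by (rule INF_greatest) (rule le)
    show "(INF \<epsilon>'\<in>{0<..\<epsilon>}. cstar M \<gamma> x \<epsilon>') \<le> ?A"
      by (rule INF_lower2[of \<epsilon>0]) (use \<epsilon>0 in auto)
  qed
  show "\<exists>\<pi>. is_arg_min (J_S3P M \<gamma> x) (\<lambda>\<pi>. \<pi> \<in> feasible M \<gamma> x \<epsilon>) \<pi>"
    if "feasible M \<gamma> x \<epsilon> \<noteq> {}"
    using J_S3P_minimizer_exists[OF \<gamma> assms(5) that] by blast
  show "\<exists>\<epsilon>'. is_arg_min (cstar M \<gamma> x) (\<lambda>\<epsilon>'. \<epsilon>' \<in> {0<..\<epsilon>}) \<epsilon>'"
    unfolding is_arg_min_linorder
    using \<epsilon>0 le by (intro exI[of _ \<epsilon>0]) (auto intro: order_trans)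
  fix \<epsilon>s
  assume s: "is_arg_min (cstar M \<gamma> x) (\<lambda>\<epsilon>'. \<epsilon>' \<in> {0<..\<epsilon>}) \<epsilon>s \<and> cstar M \<gamma> x \<epsilon>s \<noteq> \<infinity>"
  then have \<epsilon>s: "0 < \<epsilon>s" "\<epsilon>s < 1" and min: "cstar M \<gamma> x \<epsilon>s \<le> cstar M \<gamma> x \<epsilon>0"
    and in_range: "\<epsilon>s \<in> {0<..\<epsilon>}"
    using \<epsilon>0 assms(5) by (auto simp: is_arg_min_linorder)
  \<comment> \<open>Since \<open>cstar\<close> at \<open>\<epsilon>0\<close> is at most the optimal
    \<open>J_S3P\<close>, and no value of \<open>cstar\<close> on the range is below it, every
    minimizer of \<open>cstar\<close> attains it.\<close>
  have val: "?A = cstar M \<gamma> x \<epsilon>s"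
    using le[OF in_range] min \<epsilon>0(3) by simp
  have c: "cstar M \<gamma> x \<epsilon>s = ennreal (enn2real (cstar M \<gamma> x \<epsilon>s))"
    using s by (simp add: top.not_eq_extremum)
  \<comment> \<open>A finite \<open>cstar\<close> rules out an empty feasible set, over which the
    infimum would be infinite.\<close>
  have "feasible M \<gamma> x \<epsilon>s \<noteq> {}"
    using s by (auto simp: cstar_eq[OF \<gamma> \<epsilon>s])
  then have "policies M \<noteq> {}"
    by (auto simp: feasible_def)
  then show "\<exists>\<pi>s. is_arg_min (J_max M (enn2real (cstar M \<gamma> x \<epsilon>s)) \<gamma> \<epsilon>s x) (\<lambda>\<pi>. \<pi> \<in> policies M) \<pi>s"
    using J_max_minimizer_exists[OF \<gamma> enn2real_nonneg \<epsilon>s] by blast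
  show "?A = ennreal (1 / (1 - \<epsilon>s)) * J_obj M x \<pi>s"
    if "is_arg_min (J_max M (enn2real (cstar M \<gamma> x \<epsilon>s)) \<gamma> \<epsilon>s x) (\<lambda>\<pi>. \<pi> \<in> policies M) \<pi>s" for \<pi>s
    using J_obj_of_J_max_minimizer[OF \<gamma> \<epsilon>s enn2real_nonneg c that] val c by simp
qed

end
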